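(* Let $\omega\in\mathcal W_{\mathrm{Dou}}$ be a Douglas weight such that $\mathcal D(\omega)\subset H^2$. If $(\mathcal E_\omega,\mathcal D^h(\omega))$ is a regular Dirichlet form on $L^2(\mathbb T)$, then $$k^\omega(\cdot,z)=\mathcal R_\omega\, k^0(\cdot,z),\qquad z\in\mathbb D,$$ where $\mathcal R_\omega$ denotes the $1$-resolvent of $\mathcal E_\omega$.
   Context: $\mathbb D$ is the open unit disk, $\mathbb T$ the unit circle, $dA$ the normalized area measure on $\mathbb D$, $m$ the normalized Lebesgue measure on $\mathbb T$, and $L^2(\mathbb T)=L^2(\mathbb T,m)$. A weight is a measurable function $\omega:\mathbb D\to[0,\infty)$ with $\int_{\mathbb D}\omega\,dA<\infty$. For $f\in L^2(\mathbb T)$, $P[f]$ is its Poisson extension to $\mathbb D$. The gradient is normalized by $\nabla u=(\partial u,\bar\partial u)$, so $|\nabla u|^2=|\partial u|^2+|\bar\partial u|^2$ (hence $|\nabla u|=|u'|$ for holomorphic $u$). Put $$\mathcal E_\omega(f,g)=\int_{\mathbb D}\nabla P[f]\cdot\overline{\nabla P[g]}\,\omega\,dA,\qquad \mathcal D^h(\omega)=\{f\in L^2(\mathbb T):\mathcal E_\omega(f,f)<\infty\},$$ with inner product $\langle f,g\rangle_{\mathcal D^h(\omega)}=\langle f,g\rangle_{L^2(\mathbb T)}+\mathcal E_\omega(f,g)$. A weight $\omega$ belongs to $\mathcal W_{\mathrm{Dou}}$ (is a Douglas weight) if there is a positive Borel measure $\mathbf J_\omega$ on $\mathbb T^2\setminus\mathrm{diag}$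 with $\int_{\mathbb D}|\nabla P[f]|^2\omega\,dA=\int_{\mathbb T}\int_{\mathbb T}|f(\zeta)-f(\lambda)|^2\,\mathbf J_\omega(d\zeta,d\lambda)$ for every $f\in L^2(\mathbb T)$. $\mathcal D(\omega)$ is the space of holomorphic $f$ on $\mathbb D$ with $\mathcal D_\omega(f)=\int_{\mathbb D}|f'|^2\omega\,dA<\infty$. When $\mathcal D(\omega)\subset H^2$ (the Hardy space), $\mathcal D(\omega)$ with norm $\|f\|_\omega^2=\|f\|_{H^2}^2+\mathcal D_\omega(f)$ is a reproducing kernel Hilbert space on $\mathbb D$ with kernel $k^\omega$, i.e. $f(z)=\langle f,k^\omega(\cdot,z)\rangle_\omega$. $k^0(\zeta,z)=1/(1-\bar z\zeta)$ is the Szegő kernel. Elements of $H^2$ are identified with their boundary functions in $L^2(\mathbb T)$. The form is regular if it is a Dirichlet form (densely defined, closed, symmetric, Markovian) such that $\mathcal D^h(\omega)\cap C(\mathbb T)$ is dense in $\mathcal D^h(\omega)$ for its norm and dense in $C(\mathbb T)$ for the uniform norm. $\mathcal G_\omega$ is the nonnegative self-adjoint operator on $L^2(\mathbb T)$ with $\mathcal E_\omega(f,g)=\langle\mathcal G_\omega f,g\rangle_{L^2(\mathbb T)}$ for $f\in\mathcal D(\mathcal G_\omega)$, $g\in\mathcal D^h(\omega)$, and $\mathcal R_\omega=(I+\mathcal G_\omega)^{-1}$. *)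

theory Defs
  imports "HOL-Complex_Analysis.Complex_Analysis"
begin

text \<open>Normalized area measure on the open unit disc, and normalized arc length on the
  (Borel sets of the) unit circle. The underlying spaces of these measures are
  \<^term>\<open>ball 0 1\<close> and \<^term>\<open>sphere 0 1\<close>, so values of functions elsewhere are irrelevant.\<close>

definition disc_area :: "complex measure" where
  "disc_area = density (lebesgue_on (ball 0 1)) (\<lambda>_. ennreal (1 / pi))"

definition circle_measure :: "complex measure" where
  "circle_measure =
     distr (uniform_measure lborel {0..2 * pi}) (restrict_space borel (sphere 0 1)) cis"

definition weight :: "(complex \<Rightarrow> real) \<Rightarrow> bool" where
  "weight \<omega> \<longleftrightarrow> \<omega> \<in> borel_measurable disc_area \<and> (\<forall>z\<in>ball 0 1. 0 \<le> \<omega> z) \<and>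
     (\<integral>\<^sup>+z. ennreal (\<omega> z) \<partial>disc_area) < \<infinity>"


section \<open>The space $L^2$ of the circle\<close>

text \<open>\<open>L2_circle\<close> consists of functions rather than of classes modulo null sets. Operators and
  equalities in $L^2$ below are understood modulo \<open>AE \<zeta> in circle_measure\<close>.\<close>

definition L2_circle :: "(complex \<Rightarrow> complex) set" where
  "L2_circle = {f. f \<in> borel_measurable circle_measure \<and>
     integrable circle_measure (\<lambda>\<zeta>. (cmod (f \<zeta>))\<^sup>2)}"

definition L2_inner :: "(complex \<Rightarrow> complex) \<Rightarrow> (complex \<Rightarrow> complex) \<Rightarrow> complex" where
  "L2_inner f g = (LINT \<zeta>|circle_measure. f \<zeta> * cnj (g \<zeta>))"

definition L2_norm :: "(complex \<Rightarrow> complex) \<Rightarrow> real" where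
  "L2_norm f = sqrt (LINT \<zeta>|circle_measure. (cmod (f \<zeta>))\<^sup>2)"

definition L2_dense :: "(complex \<Rightarrow> complex) set \<Rightarrow> bool" where
  "L2_dense F \<longleftrightarrow> (\<forall>f\<in>L2_circle. \<forall>\<epsilon>>0. \<exists>g\<in>F. L2_norm (\<lambda>\<zeta>. f \<zeta> - g \<zeta>) < \<epsilon>)"


section \<open>Harmonic weighted Dirichlet spaces\<close>

definition poisson :: "(complex \<Rightarrow> complex) \<Rightarrow> complex \<Rightarrow> complex" where
  "poisson f z =
     (LINT \<zeta>|circle_measure. of_real ((1 - (cmod z)\<^sup>2) / (cmod (\<zeta> - z))\<^sup>2) * f \<zeta>)"

text \<open>The Wirtinger derivatives $(u_x \mp i u_y)/2$.\<close>

definition wirtinger :: "(complex \<Rightarrow> complex) \<Rightarrow> complex \<Rightarrow> complex" where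
  "wirtinger u z =
     (frechet_derivative u (at z) 1 - \<i> * frechet_derivative u (at z) \<i>) / 2"

definition wirtinger_bar :: "(complex \<Rightarrow> complex) \<Rightarrow> complex \<Rightarrow> complex" where
  "wirtinger_bar u z =
     (frechet_derivative u (at z) 1 + \<i> * frechet_derivative u (at z) \<i>) / 2"

definition energy_integral :: "(complex \<Rightarrow> real) \<Rightarrow> (complex \<Rightarrow> complex) \<Rightarrow> ennreal" where
  "energy_integral \<omega> f =
     (\<integral>\<^sup>+z. ennreal (((cmod (wirtinger (poisson f) z))\<^sup>2 +
                    (cmod (wirtinger_bar (poisson f) z))\<^sup>2) * \<omega> z) \<partial>disc_area)"

definition energy :: "(complex \<Rightarrow> real) \<Rightarrow> (complex \<Rightarrow> complex) \<Rightarrow> (complex \<Rightarrow> complex) \<Rightarrow> complex" where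
  "energy \<omega> f g =
     (LINT z|disc_area. (wirtinger (poisson f) z * cnj (wirtinger (poisson g) z) +
                         wirtinger_bar (poisson f) z * cnj (wirtinger_bar (poisson g) z)) *
                        of_real (\<omega> z))"

definition harmonic_dirichlet_space :: "(complex \<Rightarrow> real) \<Rightarrow> (complex \<Rightarrow> complex) set" where
  "harmonic_dirichlet_space \<omega> = {f \<in> L2_circle. energy_integral \<omega> f < \<infinity>}"

definition douglas_weight :: "(complex \<Rightarrow> real) \<Rightarrow> bool" where
  "douglas_weight \<omega> \<longleftrightarrow> weight \<omega> \<and>
     (\<exists>J :: (complex \<times> complex) measure.
        sets J = sets (restrict_space borel (sphere 0 1 \<times> sphere 0 1 - Id)) \<and>
        (\<forall>f\<in>L2_circle. energy_integral \<omega> f =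
           (\<integral>\<^sup>+p. ennreal ((cmod (f (fst p) - f (snd p)))\<^sup>2) \<partial>J)))"


section \<open>Dirichlet forms on complex $L^2$\<close>

text \<open>A form \<open>E\<close> with domain \<open>F\<close>; linear in the first argument, and compatible with
  equality almost everywhere.\<close>

definition symmetric_form ::
    "((complex \<Rightarrow> complex) \<Rightarrow> (complex \<Rightarrow> complex) \<Rightarrow> complex) \<Rightarrow> (complex \<Rightarrow> complex) set \<Rightarrow> bool" where
  "symmetric_form E F \<longleftrightarrow>
     F \<subseteq> L2_circle \<and> (\<lambda>_. 0) \<in> F \<and>
     (\<forall>f\<in>F. \<forall>g\<in>F. (\<lambda>\<zeta>. f \<zeta> + g \<zeta>) \<in> F) \<and>
     (\<forall>c. \<forall>f\<in>F. (\<lambda>\<zeta>. c * f \<zeta>) \<in> F) \<and>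
     (\<forall>f\<in>F. \<forall>f'\<in>L2_circle. (AE \<zeta> in circle_measure. f \<zeta> = f' \<zeta>) \<longrightarrow>
        f' \<in> F \<and> (\<forall>g\<in>F. E f' g = E f g)) \<and>
     (\<forall>f\<in>F. \<forall>g\<in>F. \<forall>h\<in>F. E (\<lambda>\<zeta>. f \<zeta> + g \<zeta>) h = E f h + E g h) \<and>
     (\<forall>c. \<forall>f\<in>F. \<forall>h\<in>F. E (\<lambda>\<zeta>. c * f \<zeta>) h = c * E f h) \<and>
     (\<forall>f\<in>F. \<forall>g\<in>F. E g f = cnj (E f g)) \<and>
     (\<forall>f\<in>F. 0 \<le> Re (E f f))"

definition form_norm ::
    "((complex \<Rightarrow> complex) \<Rightarrow> (complex \<Rightarrow> complex) \<Rightarrow> complex) \<Rightarrow> (complex \<Rightarrow> complex) \<Rightarrow> real" where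
  "form_norm E f = sqrt ((L2_norm f)\<^sup>2 + Re (E f f))"

definition closed_form ::
    "((complex \<Rightarrow> complex) \<Rightarrow> (complex \<Rightarrow> complex) \<Rightarrow> complex) \<Rightarrow> (complex \<Rightarrow> complex) set \<Rightarrow> bool" where
  "closed_form E F \<longleftrightarrow>
     (\<forall>u :: nat \<Rightarrow> complex \<Rightarrow> complex. (\<forall>n. u n \<in> F) \<longrightarrow>
        (\<forall>\<epsilon>>0. \<exists>N. \<forall>m\<ge>N. \<forall>n\<ge>N. form_norm E (\<lambda>\<zeta>. u m \<zeta> - u n \<zeta>) < \<epsilon>) \<longrightarrow>
        (\<exists>f\<in>F. (\<lambda>n. form_norm E (\<lambda>\<zeta>. u n \<zeta> - f \<zeta>)) \<longlonglongrightarrow> 0))"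

text \<open>The unit contraction acts on complex functions through the real part:
  $f \mapsto (0 \vee \mathrm{Re} f) \wedge 1$ is the orthogonal projection of complex $L^2$ onto
  the convex set of $[0,1]$-valued functions. For real $f$ this is the usual Markov property,
  and for the complexification of a real form it is equivalent to the usual Markov property.\<close>

definition markovian_form ::
    "((complex \<Rightarrow> complex) \<Rightarrow> (complex \<Rightarrow> complex) \<Rightarrow> complex) \<Rightarrow> (complex \<Rightarrow> complex) set \<Rightarrow> bool" where
  "markovian_form E F \<longleftrightarrow>
     (\<forall>f\<in>F. let g = (\<lambda>\<zeta>. complex_of_real (min (max 0 (Re (f \<zeta>))) 1))
             in g \<in> F \<and> Re (E g g) \<le> Re (E f f))"

definition dirichlet_form ::
    "((complex \<Rightarrow> complex) \<Rightarrow> (complex \<Rightarrow> complex) \<Rightarrow> complex) \<Rightarrow> (complex \<Rightarrow> complex) set \<Rightarrow> bool" where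
  "dirichlet_form E F \<longleftrightarrow>
     symmetric_form E F \<and> L2_dense F \<and> closed_form E F \<and> markovian_form E F"

definition regular_dirichlet_form ::
    "((complex \<Rightarrow> complex) \<Rightarrow> (complex \<Rightarrow> complex) \<Rightarrow> complex) \<Rightarrow> (complex \<Rightarrow> complex) set \<Rightarrow> bool" where
  "regular_dirichlet_form E F \<longleftrightarrow> dirichlet_form E F \<and>
     (\<forall>f\<in>F. \<forall>\<epsilon>>0. \<exists>g\<in>F. continuous_on (sphere 0 1) g \<and>
        form_norm E (\<lambda>\<zeta>. f \<zeta> - g \<zeta>) < \<epsilon>) \<and>
     (\<forall>f. continuous_on (sphere 0 1) f \<longrightarrow> (\<forall>\<epsilon>>0. \<exists>g\<in>F. continuous_on (sphere 0 1) g \<and>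
        (\<forall>\<zeta>\<in>sphere 0 1. cmod (f \<zeta> - g \<zeta>) < \<epsilon>)))"

text \<open>An unbounded operator is represented by its graph, a set of pairs of functions. Being dense
  and equal to the graph of the adjoint forces the graph to be linear, saturated under equality
  almost everywhere, and single-valued modulo null sets.\<close>

definition L2_adjoint ::
    "((complex \<Rightarrow> complex) \<times> (complex \<Rightarrow> complex)) set \<Rightarrow>
     ((complex \<Rightarrow> complex) \<times> (complex \<Rightarrow> complex)) set" where
  "L2_adjoint G = {(f, h). f \<in> L2_circle \<and> h \<in> L2_circle \<and>
     (\<forall>(u, v)\<in>G. L2_inner v f = L2_inner u h)}"

definition nonneg_selfadjoint :: "((complex \<Rightarrow> complex) \<times> (complex \<Rightarrow> complex)) set \<Rightarrow> bool" where
  "nonneg_selfadjoint G \<longleftrightarrow>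
     G \<subseteq> L2_circle \<times> L2_circle \<and> L2_dense (Domain G) \<and> L2_adjoint G = G \<and>
     (\<forall>(f, h)\<in>G. 0 \<le> Re (L2_inner h f))"

definition form_generator ::
    "((complex \<Rightarrow> complex) \<Rightarrow> (complex \<Rightarrow> complex) \<Rightarrow> complex) \<Rightarrow> (complex \<Rightarrow> complex) set \<Rightarrow>
     ((complex \<Rightarrow> complex) \<times> (complex \<Rightarrow> complex)) set" where
  "form_generator E F =
     (THE G. nonneg_selfadjoint G \<and> (\<forall>(f, h)\<in>G. f \<in> F \<and> (\<forall>g\<in>F. E f g = L2_inner h g)))"

text \<open>A representative of $(I + G)^{-1} f$, where $G$ is the generator of the form.\<close>

definition form_resolvent ::
    "((complex \<Rightarrow> complex) \<Rightarrow> (complex \<Rightarrow> complex) \<Rightarrow> complex) \<Rightarrow> (complex \<Rightarrow> complex) set \<Rightarrow>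
     (complex \<Rightarrow> complex) \<Rightarrow> complex \<Rightarrow> complex" where
  "form_resolvent E F f =
     (SOME u. \<exists>h. (u, h) \<in> form_generator E F \<and> (AE \<zeta> in circle_measure. u \<zeta> + h \<zeta> = f \<zeta>))"


section \<open>Hardy space and holomorphic weighted Dirichlet spaces\<close>

definition hardy2 :: "(complex \<Rightarrow> complex) set" where
  "hardy2 = {f. f holomorphic_on ball 0 1 \<and>
     bdd_above ((\<lambda>r. LINT \<zeta>|circle_measure. (cmod (f (of_real r * \<zeta>)))\<^sup>2) ` {0..<1::real})}"

text \<open>The boundary function of $f \in H^2$: the limit in $L^2$ of the dilations
  $f_r(\zeta) = f(r\zeta)$ as $r \to 1$, which is determined up to a null set.\<close>

definition boundary_function :: "(complex \<Rightarrow> complex) \<Rightarrow> complex \<Rightarrow> complex" where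
  "boundary_function f = (SOME b. b \<in> L2_circle \<and>
     ((\<lambda>r. L2_norm (\<lambda>\<zeta>. f (of_real r * \<zeta>) - b \<zeta>)) \<longlongrightarrow> 0) (at_left (1::real)))"

definition dirichlet_space :: "(complex \<Rightarrow> real) \<Rightarrow> (complex \<Rightarrow> complex) set" where
  "dirichlet_space \<omega> = {f. f holomorphic_on ball 0 1 \<and>
     (\<integral>\<^sup>+z. ennreal ((cmod (deriv f z))\<^sup>2 * \<omega> z) \<partial>disc_area) < \<infinity>}"

definition dirichlet_inner ::
    "(complex \<Rightarrow> real) \<Rightarrow> (complex \<Rightarrow> complex) \<Rightarrow> (complex \<Rightarrow> complex) \<Rightarrow> complex" where
  "dirichlet_inner \<omega> f g = L2_inner (boundary_function f) (boundary_function g) +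
     (LINT z|disc_area. deriv f z * cnj (deriv g z) * of_real (\<omega> z))"

text \<open>The reproducing kernel $k^\omega(w,z)$; the values for $w$ in the disc are unique.\<close>

definition dirichlet_kernel :: "(complex \<Rightarrow> real) \<Rightarrow> complex \<Rightarrow> complex \<Rightarrow> complex" where
  "dirichlet_kernel \<omega> w z =
     (SOME k. k \<in> dirichlet_space \<omega> \<and> (\<forall>f\<in>dirichlet_space \<omega>. f z = dirichlet_inner \<omega> f k)) w"

definition szego_kernel :: "complex \<Rightarrow> complex \<Rightarrow> complex" where
  "szego_kernel \<zeta> z = 1 / (1 - cnj z * \<zeta>)"

end

theory Submission
  imports Defs
begin

text \<open>
  The resolvent \<open>u\<close> of the Szego kernel \<open>s\<close> at \<open>z\<close> is the solution of the variational equation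
  \<open>\<E>(u, g) + \<langle>u, g\<rangle> = \<langle>s, g\<rangle>\<close> for all \<open>g\<close> of finite energy. The right-hand side is the
  conjugate of \<open>(C g)(z)\<close>, where \<open>C g\<close>, the Cauchy transform, is the analytic part of \<open>g\<close>. The
  reproducing kernel \<open>k\<close> at \<open>z\<close> is characterized by \<open>f(z) = \<langle>f, k\<rangle>\<close> for all \<open>f\<close> in the
  holomorphic space. So the theorem says that these two equations express the same thing.

  The bridge is \<open>dirichlet_inner_cauchy_transform\<close>: for \<open>f\<close> in the holomorphic space, with boundary
  function \<open>f\<^sup>*\<close>, the holomorphic inner product of \<open>f\<close> with \<open>C g\<close> equals
  \<open>\<E>(f\<^sup>*, g) + \<langle>f\<^sup>*, g\<rangle>\<close>. Three facts lead to it. The Poisson kernel is the sum of the Szego kernel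
  and its conjugate minus \<open>1\<close>, so the Wirtinger derivative of \<open>P[g]\<close> is \<open>(C g)'\<close>; in particular
  \<open>C g\<close> has finite holomorphic energy when \<open>g\<close> has finite energy, and then the assumed inclusion
  puts it in \<open>H\<^sup>2\<close>. The Poisson extension of \<open>f\<^sup>*\<close> has Wirtinger derivatives \<open>f'\<close> and \<open>0\<close>,
  because \<open>f\<^sup>*\<close> has the Taylor coefficients of \<open>f\<close> as Fourier coefficients and no others. And
  \<open>\<langle>f\<^sup>*, g\<rangle> = \<langle>f\<^sup>*, (C g)\<^sup>*\<rangle>\<close>, because \<open>g\<close> and \<open>(C g)\<^sup>*\<close> have the same Fourier coefficients
  of nonnegative index.

  Given the bridge, \<open>C u\<close> is a reproducing kernel at \<open>z\<close>, so one exists. Conversely the boundary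
  function of any reproducing kernel at \<open>z\<close> solves the variational equation, whose solution is
  unique almost everywhere.

  That the resolvent solves the variational equation is part of the representation theorem for
  closed forms. Its core is \<open>variational_solution_exists\<close>, a minimization in the form domain; from
  it one obtains that the pairs \<open>(f, h)\<close> with \<open>\<E>(f, g) = \<langle>h, g\<rangle>\<close> for all \<open>g\<close> form a self-adjoint
  operator, and that no other self-adjoint operator represents the form. The existence of boundary
  functions in \<open>H\<^sup>2\<close> follows from the completeness of \<open>L\<^sup>2\<close>, because the dilations of \<open>f\<close> are
  Cauchy.
\<close>

section \<open>Integration over the circle\<close>

lemma space_circle [simp]: "space circle_measure = sphere 0 1"
  by (simp add: circle_measure_def space_restrict_space)

lemma sets_circle [measurable_cong]:
  "sets circle_measure = sets (restrict_space borel (sphere 0 1))"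
  by (simp add: circle_measure_def)

lemma cis_measurable:
  "cis \<in> uniform_measure lborel {0..2 * pi} \<rightarrow>\<^sub>M restrict_space borel (sphere 0 1)"
proof (rule measurable_restrict_space2)
  have "cis \<in> borel_measurable borel"
    by (intro borel_measurable_continuous_onI continuous_intros)
  then show "cis \<in> uniform_measure lborel {0..2 * pi} \<rightarrow>\<^sub>M borel"
    by (simp cong: measurable_cong_sets)
qed auto

lemma measure_circle [simp]: "measure circle_measure (sphere 0 1) = 1"
  and finite_measure_circle: "finite_measure circle_measure"
proof -
  have vim: "cis -` sphere 0 1 = UNIV" by auto
  have "emeasure circle_measure (space circle_measure) =
    emeasure (uniform_measure lborel {0..2 * pi}) (cis -` sphere 0 1)"
    unfolding circle_measure_def
    by (subst emeasure_distr) (auto intro: cis_measurable simp: space_restrict_space sets_restrict_space image_iff)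
  also have "\<dots> = 1"
    by (simp add: vim ennreal_divide_self)
  finally have *: "emeasure circle_measure (space circle_measure) = 1" .
  then show "measure circle_measure (sphere 0 1) = 1"
    by (simp add: measure_def)
  show "finite_measure circle_measure"
    using * by (intro finite_measureI) simp
qed

interpretation circle: finite_measure circle_measure
  by (rule finite_measure_circle)

lemma continuous_imp_circle_measurable:
  fixes f :: "complex \<Rightarrow> 'a::topological_space"
  assumes "continuous_on (sphere 0 1) f"
  shows "f \<in> borel_measurable circle_measure"
  using borel_measurable_continuous_on_restrict[OF assms]
  by (simp cong: measurable_cong_sets add: sets_circle)

lemma circle_bounded_integrable:
  fixes f :: "complex \<Rightarrow> 'a::{banach,second_countable_topology}"
  assumes "f \<in> borel_measurable circle_measure" "\<And>\<zeta>. norm \<zeta> = 1 \<Longrightarrow> norm (f \<zeta>) \<le> B"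
  shows "integrable circle_measure f"
  by (rule circle.integrable_const_bound[where B=B]) (use assms in auto)

lemma continuous_imp_bounded_on_circle:
  fixes f :: "complex \<Rightarrow> 'a::real_normed_vector"
  assumes "continuous_on (sphere 0 1) f"
  obtains B where "\<And>\<zeta>. norm \<zeta> = 1 \<Longrightarrow> norm (f \<zeta>) \<le> B" "B \<ge> 0"
proof -
  have "bounded (f ` sphere 0 1)"
    by (intro compact_imp_bounded compact_continuous_image assms) auto
  then obtain B where "\<forall>x\<in>sphere 0 1. norm (f x) \<le> B"
    by (auto simp: bounded_iff)
  then have "norm (f \<zeta>) \<le> \<bar>B\<bar>" if "norm \<zeta> = 1" for \<zeta>
    using that by (auto intro: order_trans[OF _ abs_ge_self])
  then show thesis using that[of "\<bar>B\<bar>"] by auto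
qed

lemma circle_integral_power:
  assumes "k > 0"
  shows "(LINT \<zeta>|circle_measure. \<zeta> ^ k) = 0"
proof -
  let ?U = "uniform_measure lborel {0..2 * pi}"
  have meas: "(\<lambda>\<zeta>::complex. \<zeta> ^ k) \<in> borel_measurable (restrict_space borel (sphere 0 1))"
    by (intro borel_measurable_continuous_on_restrict continuous_intros)
  have "(LINT \<zeta>|circle_measure. \<zeta> ^ k) = (LINT t|?U. cis t ^ k)"
    unfolding circle_measure_def by (rule integral_distr[OF cis_measurable meas])
  also have "?U = density lborel (\<lambda>t. ennreal (indicator {0..2*pi} t / (2 * pi)))"
    unfolding uniform_measure_def
    by (intro arg_cong[where f="density _"] ext)
       (auto simp: indicator_def divide_ennreal ennreal_divide_numeral simp flip: ennreal_1)
  also have "(LINT t|\<dots>. cis t ^ k) =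
      (LINT t|lborel. (indicator {0..2*pi} t / (2 * pi)) *\<^sub>R (cis t ^ k))"
  proof (rule integral_density)
    have "(\<lambda>t. cis t ^ k) \<in> borel_measurable borel"
      by (intro borel_measurable_continuous_onI continuous_intros)
    then show "(\<lambda>t. cis t ^ k) \<in> borel_measurable lborel" by simp
  qed auto
  also have "\<dots> = (1 / (2*pi)) *\<^sub>R (LINT t|lborel. indicator {0..2*pi} t *\<^sub>R (cis t ^ k))"
    by (subst integral_scaleR_right[symmetric]) (simp add: mult.commute)
  also have "(LINT t|lborel. indicator {0..2*pi} t *\<^sub>R (cis t ^ k)) =
      cis (2*pi) ^ k / (\<i> * of_nat k) - cis 0 ^ k / (\<i> * of_nat k)"
  proof (rule integral_FTC_atLeastAtMost)
    show "continuous_on {0..2 * pi} (\<lambda>t. cis t ^ k)" by (intro continuous_intros)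
    fix t :: real
    have 1: "(\<lambda>t. cis t ^ k / (\<i> * of_nat k)) = (\<lambda>t. exp (\<i> * of_nat k * of_real t) / (\<i> * of_nat k))"
      by (simp add: cis_conv_exp mult_ac flip: exp_of_nat_mult)
    have 2: "cis t ^ k = exp (\<i> * of_nat k * of_real t)"
      by (simp add: cis_conv_exp mult_ac flip: exp_of_nat_mult)
    show "((\<lambda>t. cis t ^ k / (\<i> * of_nat k)) has_vector_derivative cis t ^ k) (at t within {0..2 * pi})"
      unfolding 1 2
      by (rule has_vector_derivative_real_field) (use assms in \<open>auto intro!: derivative_eq_intros\<close>)
  qed auto
  finally show ?thesis by simp
qed

lemma circle_integral_cnj_power:
  assumes "k > 0"
  shows "(LINT \<zeta>|circle_measure. cnj \<zeta> ^ k) = 0"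
  using circle_integral_power[OF assms] Bochner_Integration.integral_cnj[of circle_measure "\<lambda>\<zeta>. \<zeta> ^ k"] by simp

lemma circle_power_orthogonal:
  "(LINT \<zeta>|circle_measure. \<zeta> ^ n * cnj \<zeta> ^ m) = (if n = m then 1 else 0)"
proof -
  have red: "\<zeta> ^ (k + l) * cnj \<zeta> ^ l = \<zeta> ^ k" "\<zeta> ^ l * cnj \<zeta> ^ (k + l) = cnj \<zeta> ^ k"
    if "cmod \<zeta> = 1" for \<zeta> k l
  proof -
    have "\<zeta> * cnj \<zeta> = 1" using that by (simp add: complex_norm_square[symmetric])
    then have "\<zeta> ^ l * cnj \<zeta> ^ l = 1" by (simp flip: power_mult_distrib)
    then show "\<zeta> ^ (k + l) * cnj \<zeta> ^ l = \<zeta> ^ k" "\<zeta> ^ l * cnj \<zeta> ^ (k + l) = cnj \<zeta> ^ k"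
      by (simp_all add: power_add mult.assoc mult.left_commute)
  qed
  consider "n = m" | k where "n = k + m" "k > 0" | k where "m = k + n" "k > 0"
    by (metis add.commute less_imp_add_positive linorder_less_linear)
  then show ?thesis
  proof cases
    case 1
    have "(LINT \<zeta>|circle_measure. \<zeta> ^ n * cnj \<zeta> ^ m) = (LINT \<zeta>|circle_measure. 1)"
      by (rule Bochner_Integration.integral_cong) (use red(1)[of _ 0] 1 in auto)
    then show ?thesis using 1 by simp
  next
    case 2
    have "(LINT \<zeta>|circle_measure. \<zeta> ^ n * cnj \<zeta> ^ m) = (LINT \<zeta>|circle_measure. \<zeta> ^ k)"
      by (rule Bochner_Integration.integral_cong) (use red 2 in auto)
    then show ?thesis using 2 circle_integral_power by simp
  next
    case 3
    have "(LINT \<zeta>|circle_measure. \<zeta> ^ n * cnj \<zeta> ^ m) = (LINT \<zeta>|circle_measure. cnj \<zeta> ^ k)"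
      by (rule Bochner_Integration.integral_cong) (use red 3 in auto)
    then show ?thesis using 3 circle_integral_cnj_power by simp
  qed
qed

section \<open>Nonnegative Hermitian forms\<close>

text \<open>This framework serves three forms: the energy on its domain, the \<open>L\<^sup>2\<close> inner product,
  and the combinations \<open>c E + \<langle>\<cdot>, \<cdot>\<rangle>\<close>, whose norms for \<open>c > 0\<close> are equivalent to the form norm.\<close>

locale hermitian_form =
  fixes E :: "(complex \<Rightarrow> complex) \<Rightarrow> (complex \<Rightarrow> complex) \<Rightarrow> complex"
    and F :: "(complex \<Rightarrow> complex) set"
  assumes form: "symmetric_form E F"
begin

lemma dom_L2: "f \<in> F \<Longrightarrow> f \<in> L2_circle"
  and zero_dom: "(\<lambda>_. 0) \<in> F"
  and add_dom: "f \<in> F \<Longrightarrow> g \<in> F \<Longrightarrow> (\<lambda>\<zeta>. f \<zeta> + g \<zeta>) \<in> F"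
  and scale_dom: "f \<in> F \<Longrightarrow> (\<lambda>\<zeta>. c * f \<zeta>) \<in> F"
  and cong_dom: "f \<in> F \<Longrightarrow> f' \<in> L2_circle \<Longrightarrow> AE \<zeta> in circle_measure. f \<zeta> = f' \<zeta> \<Longrightarrow> f' \<in> F"
  and cong_left: "f \<in> F \<Longrightarrow> f' \<in> L2_circle \<Longrightarrow> AE \<zeta> in circle_measure. f \<zeta> = f' \<zeta> \<Longrightarrow> h \<in> F \<Longrightarrow> E f' h = E f h"
  and add_left: "f \<in> F \<Longrightarrow> g \<in> F \<Longrightarrow> h \<in> F \<Longrightarrow> E (\<lambda>\<zeta>. f \<zeta> + g \<zeta>) h = E f h + E g h"
  and scale_left: "f \<in> F \<Longrightarrow> h \<in> F \<Longrightarrow> E (\<lambda>\<zeta>. c * f \<zeta>) h = c * E f h"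
  and sym: "f \<in> F \<Longrightarrow> g \<in> F \<Longrightarrow> E g f = cnj (E f g)"
  and nonneg: "f \<in> F \<Longrightarrow> 0 \<le> Re (E f f)"
  using form unfolding symmetric_form_def by blast+

lemma diff_dom: "f \<in> F \<Longrightarrow> g \<in> F \<Longrightarrow> (\<lambda>\<zeta>. f \<zeta> - g \<zeta>) \<in> F"
  using add_dom[of f "\<lambda>\<zeta>. -1 * g \<zeta>"] scale_dom[of g "-1"] by simp

lemma diff_left: "f \<in> F \<Longrightarrow> g \<in> F \<Longrightarrow> h \<in> F \<Longrightarrow> E (\<lambda>\<zeta>. f \<zeta> - g \<zeta>) h = E f h - E g h"
  using add_left[of f "\<lambda>\<zeta>. -1 * g \<zeta>" h] scale_dom[of g "-1"] scale_left[of g h "-1"] by simp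

lemma add_right: "f \<in> F \<Longrightarrow> g \<in> F \<Longrightarrow> h \<in> F \<Longrightarrow> E h (\<lambda>\<zeta>. f \<zeta> + g \<zeta>) = E h f + E h g"
  using sym[of "\<lambda>\<zeta>. f \<zeta> + g \<zeta>" h] sym[of f h] sym[of g h] add_left[of f g h] add_dom[of f g] by simp

lemma diff_right: "f \<in> F \<Longrightarrow> g \<in> F \<Longrightarrow> h \<in> F \<Longrightarrow> E h (\<lambda>\<zeta>. f \<zeta> - g \<zeta>) = E h f - E h g"
  using sym[of "\<lambda>\<zeta>. f \<zeta> - g \<zeta>" h] sym[of f h] sym[of g h] diff_left[of f g h] diff_dom[of f g] by simp

lemma scale_right: "f \<in> F \<Longrightarrow> h \<in> F \<Longrightarrow> E h (\<lambda>\<zeta>. c * f \<zeta>) = cnj c * E h f"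
  using sym[of "\<lambda>\<zeta>. c * f \<zeta>" h] sym[of f h] scale_left[of f h c] scale_dom[of f c] by simp

lemmas form_simps = diff_dom add_dom scale_dom diff_left add_left scale_left diff_right add_right scale_right

lemma quadratic_add:
  assumes "f \<in> F" "g \<in> F"
  shows "Re (E (\<lambda>\<zeta>. f \<zeta> + c * g \<zeta>) (\<lambda>\<zeta>. f \<zeta> + c * g \<zeta>)) =
    Re (E f f) + 2 * Re (cnj c * E f g) + (cmod c)\<^sup>2 * Re (E g g)"
proof -
  have "E (\<lambda>\<zeta>. f \<zeta> + c * g \<zeta>) (\<lambda>\<zeta>. f \<zeta> + c * g \<zeta>) =
    E f f + (cnj c * E f g + cnj (cnj c * E f g)) + (c * cnj c) * E g g"
    using assms by (simp add: form_simps sym[of f g] algebra_simps)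
  then show ?thesis
    by (simp only: complex_norm_square[symmetric] complex_add_cnj plus_complex.sel Re_complex_of_real
        times_complex.sel Im_complex_of_real)
qed

text \<open>Nonnegativity of the quadratic form along the line through \<open>f\<close> in direction \<open>g\<close>;
  when the form vanishes on \<open>g\<close>, letting the step grow forces \<open>E f g = 0\<close>.\<close>

lemma cauchy_schwarz:
  assumes "f \<in> F" "g \<in> F"
  shows "(cmod (E f g))\<^sup>2 \<le> Re (E f f) * Re (E g g)"
proof -
  define a where "a = (cmod (E f g))\<^sup>2"
  have line: "0 \<le> Re (E f f) - 2 * t * a + t\<^sup>2 * a * Re (E g g)" for t :: real
  proof -
    define c where "c = - (of_real t * E f g)"
    have "cnj c * E f g = of_real (- t) * (E f g * cnj (E f g))"
      by (simp add: c_def)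
    also have "\<dots> = of_real (- t * a)"
      unfolding a_def of_real_mult by (simp only: complex_norm_square)
    finally have "Re (cnj c * E f g) = - t * a"
      by (simp only: Re_complex_of_real)
    moreover have "(cmod c)\<^sup>2 = t\<^sup>2 * a"
      by (simp add: c_def a_def norm_mult power_mult_distrib)
    moreover have "0 \<le> Re (E (\<lambda>\<zeta>. f \<zeta> + c * g \<zeta>) (\<lambda>\<zeta>. f \<zeta> + c * g \<zeta>))"
      by (intro nonneg add_dom scale_dom assms)
    moreover note quadratic_add[OF assms, of c]
    ultimately show ?thesis by (simp only: algebra_simps)
  qed
  define p where "p = Re (E g g)"
  have "p \<ge> 0" using nonneg[OF assms(2)] by (simp only: p_def)
  then consider "p = 0" | "p > 0" by linarith
  then have "a \<le> Re (E f f) * p"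
  proof cases
    case 1
    have "a = 0"
    proof (rule ccontr)
      assume "a \<noteq> 0"
      then have "2 * ((Re (E f f) + 1) / (2 * a)) * a = Re (E f f) + 1" by simp
      then show False
        using line[of "(Re (E f f) + 1) / (2 * a)", folded p_def, unfolded 1 mult_zero_right] by linarith
    qed
    then show ?thesis using 1 by simp
  next
    case 2
    have "(1 / p)\<^sup>2 * a * p = a / p" using 2 by (simp add: power2_eq_square)
    then have "a / p \<le> Re (E f f)"
      using line[of "1 / p", folded p_def] by simp
    then show ?thesis
      using 2 by (simp only: pos_divide_le_eq)
  qed
  then show ?thesis by (simp only: a_def p_def)
qed

lemma triangle:
  assumes "f \<in> F" "g \<in> F"
  shows "sqrt (Re (E (\<lambda>\<zeta>. f \<zeta> + g \<zeta>) (\<lambda>\<zeta>. f \<zeta> + g \<zeta>))) \<le> sqrt (Re (E f f)) + sqrt (Re (E g g))"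
proof (rule real_le_lsqrt)
  have "Re (E f g) \<le> sqrt (Re (E f f) * Re (E g g))"
    by (rule order_trans[OF complex_Re_le_cmod real_le_rsqrt[OF cauchy_schwarz[OF assms]]])
  then show "Re (E (\<lambda>\<zeta>. f \<zeta> + g \<zeta>) (\<lambda>\<zeta>. f \<zeta> + g \<zeta>)) \<le> (sqrt (Re (E f f)) + sqrt (Re (E g g)))\<^sup>2"
    using quadratic_add[OF assms, of 1] nonneg[OF assms(1)] nonneg[OF assms(2)]
    by (simp add: power2_sum real_sqrt_mult)
qed (use nonneg[OF assms(1)] nonneg[OF assms(2)] in simp_all)

end

section \<open>The space $L^2$ of the circle\<close>

lemma cnj_measurable [measurable (raw)]:
  "f \<in> borel_measurable M \<Longrightarrow> (\<lambda>x. cnj (f x)) \<in> borel_measurable M"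
  by (rule borel_measurable_continuous_on[where f=cnj]) (auto intro: continuous_intros)

lemma L2_measurable [measurable_dest]: "f \<in> L2_circle \<Longrightarrow> f \<in> borel_measurable circle_measure"
  and L2_square_integrable: "f \<in> L2_circle \<Longrightarrow> integrable circle_measure (\<lambda>\<zeta>. (cmod (f \<zeta>))\<^sup>2)"
  by (simp_all add: L2_circle_def)

lemma bounded_in_L2:
  assumes "f \<in> borel_measurable circle_measure" "\<And>\<zeta>. norm \<zeta> = 1 \<Longrightarrow> norm (f \<zeta>) \<le> B"
  shows "f \<in> L2_circle"
  unfolding L2_circle_def using assms
  by (auto intro!: circle_bounded_integrable[where B="B\<^sup>2"] power_mono)

lemma continuous_in_L2: "continuous_on (sphere 0 1) f \<Longrightarrow> f \<in> L2_circle"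
  by (metis bounded_in_L2 continuous_imp_bounded_on_circle continuous_imp_circle_measurable)

lemma L2_product_integrable:
  assumes "f \<in> L2_circle" "g \<in> L2_circle"
  shows "integrable circle_measure (\<lambda>\<zeta>. f \<zeta> * cnj (g \<zeta>))"
proof (rule Bochner_Integration.integrable_bound)
  show "integrable circle_measure (\<lambda>\<zeta>. (cmod (f \<zeta>))\<^sup>2 + (cmod (g \<zeta>))\<^sup>2)"
    using assms by (intro Bochner_Integration.integrable_add L2_square_integrable)
  show "(\<lambda>\<zeta>. f \<zeta> * cnj (g \<zeta>)) \<in> borel_measurable circle_measure"
    by (intro borel_measurable_times cnj_measurable L2_measurable assms)
  have "a * b \<le> a\<^sup>2 + b\<^sup>2" if "a \<ge> 0" "b \<ge> 0" for a b :: real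
    using sum_squares_bound[of a b] mult_nonneg_nonneg[OF that] by linarith
  then show "AE \<zeta> in circle_measure. norm (f \<zeta> * cnj (g \<zeta>)) \<le> norm ((cmod (f \<zeta>))\<^sup>2 + (cmod (g \<zeta>))\<^sup>2)"
    by (intro AE_I2) (simp add: norm_mult)
qed

lemma L2_integrable: "f \<in> L2_circle \<Longrightarrow> integrable circle_measure f"
  using L2_product_integrable[of f "\<lambda>_. 1"] continuous_in_L2[of "\<lambda>_. 1"] by simp

lemma L2_cnj: "f \<in> L2_circle \<Longrightarrow> (\<lambda>\<zeta>. cnj (f \<zeta>)) \<in> L2_circle"
  by (auto simp: L2_circle_def intro: cnj_measurable)

lemma L2_add:
  assumes "f \<in> L2_circle" "g \<in> L2_circle"
  shows "(\<lambda>\<zeta>. f \<zeta> + g \<zeta>) \<in> L2_circle"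
  unfolding L2_circle_def
proof (intro CollectI conjI)
  show m: "(\<lambda>\<zeta>. f \<zeta> + g \<zeta>) \<in> borel_measurable circle_measure"
    using assms[THEN L2_measurable] by measurable
  show "integrable circle_measure (\<lambda>\<zeta>. (cmod (f \<zeta> + g \<zeta>))\<^sup>2)"
  proof (rule Bochner_Integration.integrable_bound)
    show "integrable circle_measure (\<lambda>\<zeta>. 2 * (cmod (f \<zeta>))\<^sup>2 + 2 * (cmod (g \<zeta>))\<^sup>2)"
      using assms by (intro Bochner_Integration.integrable_add integrable_mult_right L2_square_integrable)
    show "(\<lambda>\<zeta>. (cmod (f \<zeta> + g \<zeta>))\<^sup>2) \<in> borel_measurable circle_measure"
      using m by measurable
    have "(cmod (a + b))\<^sup>2 \<le> 2 * (cmod a)\<^sup>2 + 2 * (cmod b)\<^sup>2" for a b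
    proof -
      have "(cmod (a + b))\<^sup>2 \<le> (cmod a + cmod b)\<^sup>2"
        by (intro power_mono norm_triangle_ineq) simp
      also have "\<dots> \<le> 2 * (cmod a)\<^sup>2 + 2 * (cmod b)\<^sup>2"
        using sum_squares_bound[of "cmod a" "cmod b"] by (simp add: power2_sum)
      finally show ?thesis .
    qed
    then show "AE \<zeta> in circle_measure.
        norm ((cmod (f \<zeta> + g \<zeta>))\<^sup>2) \<le> norm (2 * (cmod (f \<zeta>))\<^sup>2 + 2 * (cmod (g \<zeta>))\<^sup>2)"
      by simp
  qed
qed

lemma L2_inner_self: "L2_inner f f = of_real ((L2_norm f)\<^sup>2)"
proof -
  have "L2_inner f f = (LINT \<zeta>|circle_measure. of_real ((cmod (f \<zeta>))\<^sup>2))"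
    unfolding L2_inner_def by (simp only: complex_norm_square)
  also have "\<dots> = of_real (LINT \<zeta>|circle_measure. (cmod (f \<zeta>))\<^sup>2)"
    by (rule integral_complex_of_real)
  finally show ?thesis by (simp add: L2_norm_def)
qed

interpretation L2: hermitian_form L2_inner L2_circle
proof
  show "symmetric_form L2_inner L2_circle"
    unfolding symmetric_form_def
  proof (intro conjI ballI allI impI subset_refl)
    show "(\<lambda>_. 0) \<in> L2_circle" by (simp add: continuous_in_L2)
    fix f g assume f: "f \<in> L2_circle" and g: "g \<in> L2_circle"
    show "(\<lambda>\<zeta>. f \<zeta> + g \<zeta>) \<in> L2_circle" using f g by (rule L2_add)
    show "L2_inner g f = cnj (L2_inner f g)"
      unfolding L2_inner_def by (subst Bochner_Integration.integral_cnj[symmetric]) (simp add: mult.commute)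
    fix h assume h: "h \<in> L2_circle"
    show "L2_inner (\<lambda>\<zeta>. f \<zeta> + g \<zeta>) h = L2_inner f h + L2_inner g h"
      using f g h by (simp add: L2_inner_def distrib_right L2_product_integrable)
  next
    fix f c assume f: "f \<in> L2_circle"
    then show "(\<lambda>\<zeta>. c * f \<zeta>) \<in> L2_circle"
      by (auto simp: L2_circle_def norm_mult power_mult_distrib)
    show "0 \<le> Re (L2_inner f f)"
      unfolding L2_inner_self by simp
    fix h assume h: "h \<in> L2_circle"
    show "L2_inner (\<lambda>\<zeta>. c * f \<zeta>) h = c * L2_inner f h"
      by (simp add: L2_inner_def mult.assoc)
  next
    fix f f' g assume "f \<in> L2_circle" "f' \<in> L2_circle" "AE \<zeta> in circle_measure. f \<zeta> = f' \<zeta>" "g \<in> L2_circle"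
    then show "L2_inner f' g = L2_inner f g"
      unfolding L2_inner_def
      by (intro integral_cong_AE borel_measurable_times cnj_measurable L2_measurable) auto
  qed auto
qed

lemma L2_norm_conv_inner: "L2_norm f = sqrt (Re (L2_inner f f))"
  by (simp add: L2_inner_self L2_norm_def)

lemma L2_norm_nonneg [simp]: "0 \<le> L2_norm f"
  by (simp add: L2_norm_def)

lemma L2_cauchy_schwarz:
  assumes "f \<in> L2_circle" "g \<in> L2_circle"
  shows "cmod (L2_inner f g) \<le> L2_norm f * L2_norm g"
  using real_le_rsqrt[OF L2.cauchy_schwarz[OF assms]]
  by (simp add: L2_norm_conv_inner real_sqrt_mult)

lemma L2_triangle:
  assumes "f \<in> L2_circle" "g \<in> L2_circle" "h \<in> L2_circle"
  shows "L2_norm (\<lambda>\<zeta>. f \<zeta> - h \<zeta>) \<le> L2_norm (\<lambda>\<zeta>. f \<zeta> - g \<zeta>) + L2_norm (\<lambda>\<zeta>. g \<zeta> - h \<zeta>)"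
  using L2.triangle[of "\<lambda>\<zeta>. f \<zeta> - g \<zeta>" "\<lambda>\<zeta>. g \<zeta> - h \<zeta>"] assms
  by (simp add: L2_norm_conv_inner L2.diff_dom)

lemma L2_norm_zero_imp_AE:
  assumes "f \<in> L2_circle" "L2_norm f = 0"
  shows "AE \<zeta> in circle_measure. f \<zeta> = 0"
proof -
  have "AE \<zeta> in circle_measure. (cmod (f \<zeta>))\<^sup>2 = 0"
    using assms L2_square_integrable[OF assms(1)]
    by (subst integral_nonneg_eq_0_iff_AE[symmetric]) (auto simp: L2_norm_def)
  then show ?thesis by simp
qed

lemma L2_inner_tendsto:
  assumes "\<forall>\<^sub>F i in G. u i \<in> L2_circle" "f \<in> L2_circle" "g \<in> L2_circle"
    and "((\<lambda>i. L2_norm (\<lambda>\<zeta>. u i \<zeta> - f \<zeta>)) \<longlongrightarrow> 0) G"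
  shows "((\<lambda>i. L2_inner (u i) g) \<longlongrightarrow> L2_inner f g) G"
proof -
  have "((\<lambda>i. L2_inner (u i) g - L2_inner f g) \<longlongrightarrow> 0) G"
  proof (rule Lim_null_comparison)
    show "((\<lambda>i. L2_norm (\<lambda>\<zeta>. u i \<zeta> - f \<zeta>) * L2_norm g) \<longlongrightarrow> 0) G"
      by (rule tendsto_mult_left_zero[OF assms(4)])
    show "\<forall>\<^sub>F i in G. norm (L2_inner (u i) g - L2_inner f g) \<le> L2_norm (\<lambda>\<zeta>. u i \<zeta> - f \<zeta>) * L2_norm g"
      using assms(1)
    proof eventually_elim
      case (elim i)
      then have "L2_inner (u i) g - L2_inner f g = L2_inner (\<lambda>\<zeta>. u i \<zeta> - f \<zeta>) g"
        using assms by (simp add: L2.diff_left)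
      then show ?case using L2_cauchy_schwarz elim assms by (simp add: L2.diff_dom)
    qed
  qed
  then show ?thesis by (simp add: LIM_zero_iff)
qed

subsection \<open>Completeness\<close>

lemma L2_power [simp]: "(\<lambda>\<zeta>. \<zeta> ^ n) \<in> L2_circle"
  by (intro continuous_in_L2 continuous_intros)

lemma L2_cnj_power [simp]: "(\<lambda>\<zeta>. cnj \<zeta> ^ n) \<in> L2_circle"
  by (intro continuous_in_L2 continuous_intros)

lemma L1_le_L2_norm:
  assumes f: "f \<in> L2_circle"
  shows "(LINT \<zeta>|circle_measure. cmod (f \<zeta>)) \<le> L2_norm f"
proof -
  let ?a = "\<lambda>\<zeta>. complex_of_real (cmod (f \<zeta>))"
  have a: "?a \<in> L2_circle"
    using f by (auto simp: L2_circle_def)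
  have one: "(\<lambda>_. 1) \<in> L2_circle" by (simp add: continuous_in_L2)
  have "L2_inner ?a (\<lambda>_. 1) = of_real (LINT \<zeta>|circle_measure. cmod (f \<zeta>))"
    by (simp add: L2_inner_def)
  moreover have "L2_norm ?a = L2_norm f" "L2_norm (\<lambda>_. 1) = 1"
    by (simp_all add: L2_norm_def)
  ultimately show ?thesis
    using L2_cauchy_schwarz[OF a one] by simp
qed

text \<open>A subsequence with geometrically decreasing increments converges almost everywhere,
  because its increments are summable in \<open>L\<^sup>1\<close>; Fatou's lemma upgrades this to convergence of
  the whole sequence in \<open>L\<^sup>2\<close>.\<close>

lemma L2_complete:
  fixes u :: "nat \<Rightarrow> complex \<Rightarrow> complex"
  assumes u: "\<And>n. u n \<in> L2_circle"
    and cauchy: "\<And>\<epsilon>. \<epsilon> > 0 \<Longrightarrow> \<exists>N. \<forall>m\<ge>N. \<forall>n\<ge>N. L2_norm (\<lambda>\<zeta>. u m \<zeta> - u n \<zeta>) < \<epsilon>"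
  shows "\<exists>f\<in>L2_circle. (\<lambda>n. L2_norm (\<lambda>\<zeta>. u n \<zeta> - f \<zeta>)) \<longlonglongrightarrow> 0"
proof -
  have um [measurable]: "u n \<in> borel_measurable circle_measure" for n
    by (rule L2_measurable[OF u])
  have "\<exists>N. \<forall>m\<ge>N. \<forall>n\<ge>N. L2_norm (\<lambda>\<zeta>. u m \<zeta> - u n \<zeta>) < (1/2) ^ k" for k
    by (rule cauchy) simp
  then obtain M where M: "\<And>k m n. m \<ge> M k \<Longrightarrow> n \<ge> M k \<Longrightarrow> L2_norm (\<lambda>\<zeta>. u m \<zeta> - u n \<zeta>) < (1/2) ^ k"
    by metis
  \<comment> \<open>The sum makes \<open>s (Suc k) \<ge> M k\<close>, the summand \<open>k\<close> makes the indices tend to infinity.\<close>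
  define s where "s k = k + (\<Sum>i\<le>k. M i)" for k
  have s_ge: "s k \<ge> M k" "s (Suc k) \<ge> M k" "s k \<ge> k" for k
  proof -
    have "M k \<le> (\<Sum>i\<le>k. M i)" by (rule member_le_sum) auto
    then show "s k \<ge> M k" "s (Suc k) \<ge> M k" "s k \<ge> k"
      by (simp_all add: s_def)
  qed
  define d where "d k \<zeta> = u (s (Suc k)) \<zeta> - u (s k) \<zeta>" for k \<zeta>
  have dL2: "d k \<in> L2_circle" for k
    unfolding d_def by (intro L2.diff_dom u)
  have dm [measurable]: "d k \<in> borel_measurable circle_measure" for k
    by (rule L2_measurable[OF dL2])
  have d_int: "(\<integral>\<^sup>+\<zeta>. ennreal (cmod (d k \<zeta>)) \<partial>circle_measure) \<le> ennreal ((1/2) ^ k)" for k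
  proof -
    have "(\<integral>\<^sup>+\<zeta>. ennreal (cmod (d k \<zeta>)) \<partial>circle_measure) = ennreal (LINT \<zeta>|circle_measure. cmod (d k \<zeta>))"
      by (intro nn_integral_eq_integral integrable_norm L2_integrable dL2) simp
    also have "(LINT \<zeta>|circle_measure. cmod (d k \<zeta>)) \<le> (1/2) ^ k"
      using L1_le_L2_norm[OF dL2[of k]] M[OF s_ge(2) s_ge(1), of k] unfolding d_def by linarith
    finally show ?thesis by (simp add: ennreal_leI)
  qed
  have "(\<integral>\<^sup>+\<zeta>. (\<Sum>k. ennreal (cmod (d k \<zeta>))) \<partial>circle_measure) =
      (\<Sum>k. \<integral>\<^sup>+\<zeta>. ennreal (cmod (d k \<zeta>)) \<partial>circle_measure)"
    by (intro nn_integral_suminf) measurable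
  also have "\<dots> \<le> (\<Sum>k. ennreal ((1/2) ^ k))"
    by (intro suminf_le d_int) auto
  also have "\<dots> = ennreal (\<Sum>k. (1/2) ^ k)"
    by (intro suminf_ennreal2 summable_geometric) auto
  also have "\<dots> < \<infinity>" by simp
  finally have fin: "(\<integral>\<^sup>+\<zeta>. (\<Sum>k. ennreal (cmod (d k \<zeta>))) \<partial>circle_measure) \<noteq> \<infinity>"
    by (rule less_imp_neq)
  have "AE \<zeta> in circle_measure. (\<Sum>k. ennreal (cmod (d k \<zeta>))) \<noteq> \<infinity>"
    by (rule nn_integral_PInf_AE[OF _ fin]) measurable
  then have conv: "AE \<zeta> in circle_measure. convergent (\<lambda>k. u (s k) \<zeta>)"
  proof eventually_elim
    case (elim \<zeta>)
    then have "summable (\<lambda>k. cmod (d k \<zeta>))"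
      by (intro summable_suminf_not_top) simp_all
    then have "summable (\<lambda>k. u (s (Suc k)) \<zeta> - u (s k) \<zeta>)"
      unfolding d_def by (rule summable_norm_cancel)
    then have "convergent (\<lambda>n. (\<Sum>k<n. u (s (Suc k)) \<zeta> - u (s k) \<zeta>) + u (s 0) \<zeta>)"
      by (intro convergent_add convergent_const) (simp add: summable_iff_convergent)
    then show ?case by (simp add: sum_lessThan_telescope[of "\<lambda>k. u (s k) \<zeta>"])
  qed
  define f where "f \<zeta> = lim (\<lambda>k. u (s k) \<zeta>)" for \<zeta>
  have fm [measurable]: "f \<in> borel_measurable circle_measure"
    unfolding f_def by measurable
  have lim: "AE \<zeta> in circle_measure. (\<lambda>k. u (s k) \<zeta>) \<longlonglongrightarrow> f \<zeta>"
    using conv by eventually_elim (simp add: f_def convergent_LIMSEQ_iff)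
  have fatou: "(\<integral>\<^sup>+\<zeta>. ennreal ((cmod (u n \<zeta> - f \<zeta>))\<^sup>2) \<partial>circle_measure) \<le> ennreal (\<epsilon>\<^sup>2)"
    if N: "\<And>m. m \<ge> N \<Longrightarrow> L2_norm (\<lambda>\<zeta>. u n \<zeta> - u m \<zeta>) < \<epsilon>" for N n \<epsilon>
  proof -
    have "(\<integral>\<^sup>+\<zeta>. ennreal ((cmod (u n \<zeta> - f \<zeta>))\<^sup>2) \<partial>circle_measure) =
        (\<integral>\<^sup>+\<zeta>. liminf (\<lambda>k. ennreal ((cmod (u n \<zeta> - u (s k) \<zeta>))\<^sup>2)) \<partial>circle_measure)"
    proof (rule nn_integral_cong_AE)
      show "AE \<zeta> in circle_measure. ennreal ((cmod (u n \<zeta> - f \<zeta>))\<^sup>2) =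
          liminf (\<lambda>k. ennreal ((cmod (u n \<zeta> - u (s k) \<zeta>))\<^sup>2))"
        using lim
      proof eventually_elim
        case (elim \<zeta>)
        have "(\<lambda>k. ennreal ((cmod (u n \<zeta> - u (s k) \<zeta>))\<^sup>2)) \<longlonglongrightarrow> ennreal ((cmod (u n \<zeta> - f \<zeta>))\<^sup>2)"
          by (intro tendsto_ennrealI tendsto_intros elim)
        then show ?case by (rule lim_imp_Liminf[OF trivial_limit_sequentially, symmetric])
      qed
    qed
    also have "\<dots> \<le> liminf (\<lambda>k. \<integral>\<^sup>+\<zeta>. ennreal ((cmod (u n \<zeta> - u (s k) \<zeta>))\<^sup>2) \<partial>circle_measure)"
      by (intro nn_integral_liminf) measurable
    also have "\<dots> \<le> ennreal (\<epsilon>\<^sup>2)"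
    proof (rule Liminf_le)
      have "(\<integral>\<^sup>+\<zeta>. ennreal ((cmod (u n \<zeta> - u (s k) \<zeta>))\<^sup>2) \<partial>circle_measure) \<le> ennreal (\<epsilon>\<^sup>2)" if "k \<ge> N" for k
      proof -
        let ?w = "\<lambda>\<zeta>. u n \<zeta> - u (s k) \<zeta>"
        have w: "?w \<in> L2_circle" by (intro L2.diff_dom u)
        have "(\<integral>\<^sup>+\<zeta>. ennreal ((cmod (?w \<zeta>))\<^sup>2) \<partial>circle_measure) =
            ennreal (LINT \<zeta>|circle_measure. (cmod (?w \<zeta>))\<^sup>2)"
          by (intro nn_integral_eq_integral L2_square_integrable w) simp
        also have "\<dots> = ennreal ((L2_norm ?w)\<^sup>2)"
          by (simp add: L2_norm_def)
        also have "\<dots> \<le> ennreal (\<epsilon>\<^sup>2)"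
          using N[of "s k"] s_ge(3)[of k] that by (intro ennreal_leI power_mono) auto
        finally show ?thesis .
      qed
      then show "\<forall>\<^sub>F k in sequentially.
          (\<integral>\<^sup>+\<zeta>. ennreal ((cmod (u n \<zeta> - u (s k) \<zeta>))\<^sup>2) \<partial>circle_measure) \<le> ennreal (\<epsilon>\<^sup>2)"
        by (rule eventually_sequentiallyI)
    qed simp
    finally show ?thesis .
  qed
  have diff_L2: "(\<lambda>\<zeta>. u n \<zeta> - f \<zeta>) \<in> L2_circle \<and> L2_norm (\<lambda>\<zeta>. u n \<zeta> - f \<zeta>) \<le> \<epsilon>"
    if "\<And>m. m \<ge> N \<Longrightarrow> L2_norm (\<lambda>\<zeta>. u n \<zeta> - u m \<zeta>) < \<epsilon>" "\<epsilon> > 0" for N n \<epsilon>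
  proof -
    have bound: "(\<integral>\<^sup>+\<zeta>. ennreal ((cmod (u n \<zeta> - f \<zeta>))\<^sup>2) \<partial>circle_measure) \<le> ennreal (\<epsilon>\<^sup>2)"
      by (rule fatou[of N]) (rule that(1))
    have int: "integrable circle_measure (\<lambda>\<zeta>. (cmod (u n \<zeta> - f \<zeta>))\<^sup>2)"
    proof (rule integrableI_bounded)
      show "(\<integral>\<^sup>+\<zeta>. ennreal (norm ((cmod (u n \<zeta> - f \<zeta>))\<^sup>2)) \<partial>circle_measure) < \<infinity>"
        using le_less_trans[OF bound ennreal_less_top] by simp
    qed measurable
    have "ennreal (LINT \<zeta>|circle_measure. (cmod (u n \<zeta> - f \<zeta>))\<^sup>2) \<le> ennreal (\<epsilon>\<^sup>2)"
      using bound by (subst nn_integral_eq_integral[symmetric, OF int]) auto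
    then have "(LINT \<zeta>|circle_measure. (cmod (u n \<zeta> - f \<zeta>))\<^sup>2) \<le> \<epsilon>\<^sup>2"
      by (simp add: ennreal_le_iff)
    then have "L2_norm (\<lambda>\<zeta>. u n \<zeta> - f \<zeta>) \<le> \<epsilon>"
      unfolding L2_norm_def using that(2) by (intro real_le_lsqrt) auto
    moreover have "(\<lambda>\<zeta>. u n \<zeta> - f \<zeta>) \<in> L2_circle"
      using int by (simp add: L2_circle_def)
    ultimately show ?thesis by simp
  qed
  have small: "\<exists>N. \<forall>n\<ge>N. (\<lambda>\<zeta>. u n \<zeta> - f \<zeta>) \<in> L2_circle \<and> L2_norm (\<lambda>\<zeta>. u n \<zeta> - f \<zeta>) \<le> \<epsilon>" if pos: "\<epsilon> > 0" for \<epsilon>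
  proof -
    obtain N where "\<forall>m\<ge>N. \<forall>n\<ge>N. L2_norm (\<lambda>\<zeta>. u m \<zeta> - u n \<zeta>) < \<epsilon>"
      using cauchy[OF pos] by blast
    then show ?thesis using diff_L2[OF _ pos, of N] by blast
  qed
  have "f \<in> L2_circle"
  proof -
    obtain n where "(\<lambda>\<zeta>. u n \<zeta> - f \<zeta>) \<in> L2_circle"
      using small[of 1] by auto
    from L2.diff_dom[OF u[of n] this] show ?thesis by simp
  qed
  moreover have "(\<lambda>n. L2_norm (\<lambda>\<zeta>. u n \<zeta> - f \<zeta>)) \<longlonglongrightarrow> 0"
  proof (rule LIMSEQ_I)
    fix e :: real assume "e > 0"
    then obtain N where "\<forall>n\<ge>N. L2_norm (\<lambda>\<zeta>. u n \<zeta> - f \<zeta>) \<le> e / 2"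
      using small[of "e / 2"] by auto
    then show "\<exists>N. \<forall>n\<ge>N. norm (L2_norm (\<lambda>\<zeta>. u n \<zeta> - f \<zeta>) - 0) < e"
      using \<open>e > 0\<close> by (intro exI[of _ N]) fastforce
  qed
  ultimately show ?thesis by blast
qed

section \<open>The resolvent of a closed form\<close>

text \<open>First-order condition at a minimum: the step \<open>t = - s L\<close> gives \<open>s \<bar>L\<bar>\<^sup>2 (s N - 2)\<close>, which is
  negative for small \<open>s > 0\<close> unless \<open>L = 0\<close>.\<close>

lemma linear_part_zero_if_nonneg:
  fixes L :: complex
  assumes "\<And>t. 0 \<le> 2 * Re (cnj t * L) + (cmod t)\<^sup>2 * N"
  shows "L = 0"
proof (rule ccontr)
  assume "L \<noteq> 0"
  define s where "s = 1 / (\<bar>N\<bar> + 1)"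
  define b where "b = (cmod L)\<^sup>2"
  have s: "s > 0" "s * N < 1" by (auto simp: s_def)
  have b: "b > 0" using \<open>L \<noteq> 0\<close> by (simp add: b_def)
  have "cnj (- of_real s * L) * L = of_real (- s) * (L * cnj L)" by simp
  also have "\<dots> = of_real (- s * b)" unfolding b_def of_real_mult by (simp only: complex_norm_square)
  finally have "Re (cnj (- of_real s * L) * L) = - s * b" by (simp only: Re_complex_of_real)
  moreover have "(cmod (- of_real s * L))\<^sup>2 = s * s * b"
    by (simp add: norm_mult power_mult_distrib b_def power2_eq_square)
  ultimately have "0 \<le> 2 * (- s * b) + s * s * b * N"
    using assms[of "- of_real s * L"] by (simp only:)
  also have "\<dots> = (s * b) * (s * N - 2)" by algebra
  finally have "0 \<le> (s * b) * (s * N - 2)" .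
  moreover have "(s * b) * (s * N - 2) < 0"
    using s b by (intro mult_pos_neg) simp_all
  ultimately show False by linarith
qed

context hermitian_form
begin

lemma tendsto_left:
  assumes "\<And>n. u n \<in> F" "v \<in> F" "g \<in> F"
    and "(\<lambda>n::nat. Re (E (\<lambda>\<zeta>. u n \<zeta> - v \<zeta>) (\<lambda>\<zeta>. u n \<zeta> - v \<zeta>))) \<longlonglongrightarrow> 0"
  shows "(\<lambda>n. E (u n) g) \<longlonglongrightarrow> E v g"
proof -
  let ?N = "\<lambda>n. Re (E (\<lambda>\<zeta>. u n \<zeta> - v \<zeta>) (\<lambda>\<zeta>. u n \<zeta> - v \<zeta>))"
  have "(\<lambda>n. E (u n) g - E v g) \<longlonglongrightarrow> 0"
  proof (rule Lim_null_comparison)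
    have "(\<lambda>n. sqrt (?N n * Re (E g g))) \<longlonglongrightarrow> sqrt (0 * Re (E g g))"
      by (intro tendsto_intros assms)
    then show "(\<lambda>n. sqrt (?N n * Re (E g g))) \<longlonglongrightarrow> 0" by simp
    show "\<forall>\<^sub>F n in sequentially. norm (E (u n) g - E v g) \<le> sqrt (?N n * Re (E g g))"
      using assms by (auto simp: diff_left[symmetric] intro!: always_eventually real_le_rsqrt cauchy_schwarz diff_dom)
  qed
  then show ?thesis by (simp add: LIM_zero_iff)
qed

lemma shifted_form:
  assumes "c \<ge> 0"
  shows "hermitian_form (\<lambda>f g. of_real c * E f g + L2_inner f g) F"
proof
  show "symmetric_form (\<lambda>f g. of_real c * E f g + L2_inner f g) F"
    unfolding symmetric_form_def
  proof (intro conjI ballI allI impI)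
    fix f assume f: "f \<in> F"
    have "Re (of_real c * E f f) \<ge> 0" "Re (L2_inner f f) \<ge> 0"
      using assms nonneg[OF f] L2.nonneg[OF dom_L2[OF f]] by simp_all
    then show "0 \<le> Re (of_real c * E f f + L2_inner f f)"
      by simp
  next
    fix f g assume "f \<in> F" "g \<in> F"
    then show "of_real c * E g f + L2_inner g f = cnj (of_real c * E f g + L2_inner f g)"
      using sym[of f g] L2.sym[of f g] dom_L2 by simp
  next
    fix f f' g assume "f \<in> F" "f' \<in> L2_circle" "AE \<zeta> in circle_measure. f \<zeta> = f' \<zeta>" "g \<in> F"
    then show "of_real c * E f' g + L2_inner f' g = of_real c * E f g + L2_inner f g"
      using cong_left[of f f' g] L2.cong_left[of f f' g] dom_L2 by simp
  qed (auto simp: dom_L2 zero_dom L2.form_simps form_simps algebra_simps intro: cong_dom)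
qed

end

locale closed_hermitian_form = hermitian_form +
  assumes closed: "closed_form E F" and dense: "L2_dense F"
begin

text \<open>Riesz representation without passing to a quotient space: the solution minimizes
  \<open>N u - 2 Re \<langle>u, f\<rangle>\<close>, where \<open>N\<close> is the square of the norm of the shifted form. By the
  parallelogram identity a minimizing sequence is Cauchy for \<open>N\<close>, so closedness supplies a limit,
  and minimality in the direction of every \<open>g\<close> is the claimed equation.\<close>

lemma variational_solution_exists:
  fixes c :: real
  assumes c: "c > 0" and f: "f \<in> L2_circle"
  shows "\<exists>u\<in>F. \<forall>g\<in>F. of_real c * E u g + L2_inner u g = L2_inner f g"
proof -
  define a where "a = (\<lambda>f g. of_real c * E f g + L2_inner f g)"
  interpret A: hermitian_form a F
    unfolding a_def using c by (intro shifted_form) simp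
  define N where "N u = Re (a u u)" for u
  define Q where "Q u = N u - 2 * Re (L2_inner u f)" for u
  have N_eq: "N u = c * Re (E u u) + (L2_norm u)\<^sup>2" for u
    by (simp add: N_def a_def L2_inner_self flip: of_real_power)
  have Q_lower: "- (L2_norm f)\<^sup>2 \<le> Q u" if u: "u \<in> F" for u
  proof -
    have "0 \<le> Re (L2_inner (\<lambda>\<zeta>. u \<zeta> + (-1) * f \<zeta>) (\<lambda>\<zeta>. u \<zeta> + (-1) * f \<zeta>))"
      by (intro L2.nonneg L2.add_dom L2.scale_dom dom_L2 u f)
    also have "\<dots> = (L2_norm u)\<^sup>2 - 2 * Re (L2_inner u f) + (L2_norm f)\<^sup>2"
      using L2.quadratic_add[OF dom_L2[OF u] f, of "-1"] by (simp add: L2_inner_self flip: of_real_power)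
    finally have "0 \<le> (L2_norm u)\<^sup>2 - 2 * Re (L2_inner u f) + (L2_norm f)\<^sup>2" .
    moreover have "0 \<le> c * Re (E u u)"
      using c nonneg[OF u] by simp
    ultimately show ?thesis by (simp add: Q_def N_eq)
  qed
  have Q_add: "Q (\<lambda>\<zeta>. u \<zeta> + t * g \<zeta>) = Q u + 2 * Re (cnj t * (a u g - L2_inner f g)) + (cmod t)\<^sup>2 * N g"
    if u: "u \<in> F" and g: "g \<in> F" for u g t
  proof -
    have "L2_inner (\<lambda>\<zeta>. u \<zeta> + t * g \<zeta>) f = L2_inner u f + cnj (cnj t * L2_inner f g)"
      using u g f L2.sym[of g f] by (simp add: L2.form_simps dom_L2)
    then show ?thesis
      unfolding Q_def N_def A.quadratic_add[OF u g] by (simp add: algebra_simps)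
  qed
  define m where "m = Inf (Q ` F)"
  have bdd: "bdd_below (Q ` F)"
    using Q_lower by (auto intro!: bdd_belowI)
  have m_le: "m \<le> Q u" if "u \<in> F" for u
    unfolding m_def using bdd that by (auto intro: cInf_lower)
  have "\<exists>u\<in>F. Q u < m + 1 / Suc n" for n
  proof -
    have "m < m + 1 / Suc n" by simp
    then show ?thesis
      unfolding m_def using cInf_lessD[of "Q ` F"] zero_dom by blast
  qed
  then obtain u where uF: "\<And>n. u n \<in> F" and uQ: "\<And>n. Q (u n) < m + 1 / Suc n"
    by metis
  have N_diff: "N (\<lambda>\<zeta>. v \<zeta> - w \<zeta>) \<le> 2 * Q w + 2 * Q v - 4 * m" if v: "v \<in> F" and w: "w \<in> F" for v w
  proof -
    let ?d = "\<lambda>\<zeta>. v \<zeta> - w \<zeta>"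
    have d: "?d \<in> F" using v w by (rule diff_dom)
    have "(\<lambda>\<zeta>. w \<zeta> + (1/2) * ?d \<zeta>) \<in> F"
      by (intro add_dom scale_dom w d)
    from m_le[OF this] have "m \<le> Q w + Re (a w ?d - L2_inner f ?d) + N ?d / 4"
      unfolding Q_add[OF w d] by (simp add: power2_eq_square diff_divide_distrib)
    moreover have "Q v = Q w + 2 * Re (a w ?d - L2_inner f ?d) + N ?d"
      using Q_add[OF w d, of 1] by simp
    ultimately show ?thesis by linarith
  qed
  have form_norm_le: "form_norm E v \<le> sqrt (max 1 (1/c) * N v)" if v: "v \<in> F" for v
  proof -
    let ?K = "max 1 (1/c)"
    have "1 * (L2_norm v)\<^sup>2 \<le> ?K * (L2_norm v)\<^sup>2"
      by (rule mult_right_mono) simp_all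
    moreover have "1 \<le> ?K * c"
      using c by (metis max.cobounded2 pos_divide_le_eq)
    then have "1 * Re (E v v) \<le> (?K * c) * Re (E v v)"
      by (rule mult_right_mono) (rule nonneg[OF v])
    ultimately show ?thesis
      unfolding form_norm_def N_eq by (simp add: algebra_simps)
  qed
  have "\<exists>M. \<forall>i\<ge>M. \<forall>j\<ge>M. form_norm E (\<lambda>\<zeta>. u i \<zeta> - u j \<zeta>) < \<epsilon>" if "\<epsilon> > 0" for \<epsilon>
  proof -
    let ?K = "max 1 (1/c)"
    have K: "?K > 0" by simp
    then have "\<epsilon>\<^sup>2 / (4 * ?K) > 0" using \<open>\<epsilon> > 0\<close> by simp
    then obtain M where M: "1 / Suc M < \<epsilon>\<^sup>2 / (4 * ?K)"
      using nat_approx_posE by blast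
    have "form_norm E (\<lambda>\<zeta>. u i \<zeta> - u j \<zeta>) < \<epsilon>" if "i \<ge> M" "j \<ge> M" for i j
    proof -
      have less: "1 / Suc k < \<epsilon>\<^sup>2 / (4 * ?K)" if "k \<ge> M" for k
      proof -
        have "1 / real (Suc k) \<le> 1 / Suc M" using that by (intro divide_left_mono) auto
        then show ?thesis using M by linarith
      qed
      have "N (\<lambda>\<zeta>. u i \<zeta> - u j \<zeta>) < 4 * (\<epsilon>\<^sup>2 / (4 * ?K))"
        using N_diff[OF uF uF, of i j] uQ[of i] uQ[of j] less[OF \<open>i \<ge> M\<close>] less[OF \<open>j \<ge> M\<close>] by linarith
      also have "\<dots> = \<epsilon>\<^sup>2 / ?K" by simp
      finally have "?K * N (\<lambda>\<zeta>. u i \<zeta> - u j \<zeta>) < \<epsilon>\<^sup>2"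
        using K by (metis mult.commute pos_less_divide_eq)
      then have "sqrt (?K * N (\<lambda>\<zeta>. u i \<zeta> - u j \<zeta>)) < \<epsilon>"
        using \<open>\<epsilon> > 0\<close> by (intro real_less_lsqrt) auto
      then show ?thesis
        using form_norm_le[OF diff_dom[OF uF uF], of i j] by linarith
    qed
    then show ?thesis by blast
  qed
  then have "\<exists>v\<in>F. (\<lambda>n. form_norm E (\<lambda>\<zeta>. u n \<zeta> - v \<zeta>)) \<longlonglongrightarrow> 0"
    using closed[unfolded closed_form_def, THEN spec[of _ u]] uF by blast
  then obtain v where vF: "v \<in> F" and lim: "(\<lambda>n. form_norm E (\<lambda>\<zeta>. u n \<zeta> - v \<zeta>)) \<longlonglongrightarrow> 0"
    by blast
  have N_lim: "(\<lambda>n. N (\<lambda>\<zeta>. u n \<zeta> - v \<zeta>)) \<longlonglongrightarrow> 0"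
  proof (rule Lim_null_comparison)
    have "(\<lambda>n. max 1 c * (form_norm E (\<lambda>\<zeta>. u n \<zeta> - v \<zeta>))\<^sup>2) \<longlonglongrightarrow> max 1 c * 0\<^sup>2"
      by (intro tendsto_intros lim)
    then show "(\<lambda>n. max 1 c * (form_norm E (\<lambda>\<zeta>. u n \<zeta> - v \<zeta>))\<^sup>2) \<longlonglongrightarrow> 0" by simp
    have "norm (N w) \<le> max 1 c * (form_norm E w)\<^sup>2" if "w \<in> F" for w
    proof -
      have "c * Re (E w w) \<le> max 1 c * Re (E w w)" "1 * (L2_norm w)\<^sup>2 \<le> max 1 c * (L2_norm w)\<^sup>2"
        by (rule mult_right_mono; use nonneg[OF that] in simp)+
      moreover have "0 \<le> N w" using A.nonneg[OF that] by (simp add: N_def)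
      ultimately show ?thesis
        using nonneg[OF that] by (simp add: form_norm_def N_eq algebra_simps)
    qed
    then show "\<forall>\<^sub>F n in sequentially.
        norm (N (\<lambda>\<zeta>. u n \<zeta> - v \<zeta>)) \<le> max 1 c * (form_norm E (\<lambda>\<zeta>. u n \<zeta> - v \<zeta>))\<^sup>2"
      using diff_dom[OF uF vF] by simp
  qed
  have "a v g - L2_inner f g = 0" if g: "g \<in> F" for g
  proof (rule linear_part_zero_if_nonneg)
    fix t :: complex
    let ?L = "\<lambda>w. a w g - L2_inner f g"
    have "(\<lambda>n. a (u n) g) \<longlonglongrightarrow> a v g"
      by (rule A.tendsto_left) (use uF vF g N_lim in \<open>auto simp: N_def\<close>)
    then have "(\<lambda>n. 1 / Suc n + 2 * Re (cnj t * ?L (u n)) + (cmod t)\<^sup>2 * N g) \<longlonglongrightarrow>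
        0 + 2 * Re (cnj t * ?L v) + (cmod t)\<^sup>2 * N g"
      by (intro tendsto_intros LIMSEQ_Suc[OF lim_1_over_n])
    moreover have "\<exists>M. \<forall>n\<ge>M. 0 \<le> 1 / Suc n + 2 * Re (cnj t * ?L (u n)) + (cmod t)\<^sup>2 * N g"
    proof (intro exI allI impI)
      fix n
      show "0 \<le> 1 / Suc n + 2 * Re (cnj t * ?L (u n)) + (cmod t)\<^sup>2 * N g"
        using m_le[OF add_dom[OF uF[of n] scale_dom[OF g, of t]]] uQ[of n]
        unfolding Q_add[OF uF g] by linarith
    qed
    ultimately have "0 \<le> 0 + 2 * Re (cnj t * ?L v) + (cmod t)\<^sup>2 * N g"
      by (rule LIMSEQ_le_const)
    then show "0 \<le> 2 * Re (cnj t * ?L v) + (cmod t)\<^sup>2 * N g"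
      by simp
  qed
  then show ?thesis
    using vF by (auto simp: a_def)
qed

text \<open>The operator of the form in its weak description. It turns out to be the value of
  \<^const>\<open>form_generator\<close>, whose definite description presupposes that such an operator exists and is
  unique.\<close>

definition generator :: "((complex \<Rightarrow> complex) \<times> (complex \<Rightarrow> complex)) set" where
  "generator = {(f, h). f \<in> F \<and> h \<in> L2_circle \<and> (\<forall>g\<in>F. E f g = L2_inner h g)}"

lemma generator_resolvent_exists:
  assumes c: "c > 0" and f: "f \<in> L2_circle"
  shows "\<exists>u. (u, \<lambda>\<zeta>. of_real (1 / c) * (f \<zeta> - u \<zeta>)) \<in> generator"
proof -
  obtain u where u: "u \<in> F" and eq: "\<And>g. g \<in> F \<Longrightarrow> of_real c * E u g + L2_inner u g = L2_inner f g"
    using variational_solution_exists[OF c f] by blast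
  have u2: "u \<in> L2_circle" by (rule dom_L2[OF u])
  have d: "(\<lambda>\<zeta>. f \<zeta> - u \<zeta>) \<in> L2_circle" by (rule L2.diff_dom[OF f u2])
  have "E u g = L2_inner (\<lambda>\<zeta>. of_real (1 / c) * (f \<zeta> - u \<zeta>)) g" if g: "g \<in> F" for g
  proof -
    have "of_real c * E u g = L2_inner f g - L2_inner u g"
      using eq[OF g] by (simp only: eq_diff_eq)
    moreover have "of_real (1 / c) * (of_real c * E u g) = E u g"
      using c by simp
    ultimately show ?thesis
      unfolding L2.scale_left[OF d dom_L2[OF g]] L2.diff_left[OF f u2 dom_L2[OF g]] by (simp only:)
  qed
  then have "(u, \<lambda>\<zeta>. of_real (1 / c) * (f \<zeta> - u \<zeta>)) \<in> generator"
    unfolding generator_def using u L2.scale_dom[OF d, of "of_real (1 / c)"] by simp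
  then show ?thesis by (intro exI)
qed

text \<open>The solutions \<open>u\<close> of \<open>c G u + u = g\<close> converge to \<open>g\<close> as \<open>c\<close> tends to \<open>0\<close>, because
  \<open>\<parallel>g - u\<parallel>\<^sup>2 = c Re (E u g - E u u)\<close>, which is at most \<open>c E g g / 4\<close>.\<close>

lemma generator_domain_dense: "L2_dense (Domain generator)"
  unfolding L2_dense_def
proof (intro ballI allI impI)
  fix f :: "complex \<Rightarrow> complex" and \<epsilon> :: real
  assume f: "f \<in> L2_circle" and e: "\<epsilon> > 0"
  then obtain g where g: "g \<in> F" and fg: "L2_norm (\<lambda>\<zeta>. f \<zeta> - g \<zeta>) < \<epsilon> / 2"
    using dense unfolding L2_dense_def by (meson half_gt_zero)
  define s where "s = Re (E g g)"
  have s: "s \<ge> 0" using nonneg[OF g] by (simp only: s_def)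
  \<comment> \<open>The denominator is \<open>s + 1\<close> because \<open>s\<close> may vanish.\<close>
  define c where "c = \<epsilon>\<^sup>2 / (s + 1)"
  have c: "c > 0" using e s by (simp add: c_def)
  obtain u where u: "(u, \<lambda>\<zeta>. of_real (1 / c) * (g \<zeta> - u \<zeta>)) \<in> generator"
    using generator_resolvent_exists[OF c dom_L2[OF g]] by blast
  then have uF: "u \<in> F" by (simp add: generator_def)
  have gu: "(\<lambda>\<zeta>. g \<zeta> - u \<zeta>) \<in> F" using g uF by (rule diff_dom)
  have "E u (\<lambda>\<zeta>. g \<zeta> - u \<zeta>) = L2_inner (\<lambda>\<zeta>. of_real (1 / c) * (g \<zeta> - u \<zeta>)) (\<lambda>\<zeta>. g \<zeta> - u \<zeta>)"
    using u gu by (simp add: generator_def)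
  also have "\<dots> = of_real (1 / c) * of_real ((L2_norm (\<lambda>\<zeta>. g \<zeta> - u \<zeta>))\<^sup>2)"
    unfolding L2.scale_left[OF dom_L2[OF gu] dom_L2[OF gu]] L2_inner_self ..
  finally have "Re (E u (\<lambda>\<zeta>. g \<zeta> - u \<zeta>)) = 1 / c * (L2_norm (\<lambda>\<zeta>. g \<zeta> - u \<zeta>))\<^sup>2"
    unfolding of_real_mult[symmetric] by (simp only: Re_complex_of_real)
  then have "Re (E u (\<lambda>\<zeta>. g \<zeta> - u \<zeta>)) = (L2_norm (\<lambda>\<zeta>. g \<zeta> - u \<zeta>))\<^sup>2 / c"
    by simp
  moreover have "Re (E u (\<lambda>\<zeta>. g \<zeta> - u \<zeta>)) = Re (E u g) - Re (E u u)"
    using g uF by (simp add: diff_right)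
  moreover have "0 \<le> s + 2 * Re (cnj (-2) * E g u) + (cmod (-2))\<^sup>2 * Re (E u u)"
    unfolding s_def quadratic_add[OF g uF, symmetric] by (intro nonneg add_dom scale_dom g uF)
  moreover have "Re (E g u) = Re (E u g)"
    using sym[OF uF g] by simp
  ultimately have "(L2_norm (\<lambda>\<zeta>. g \<zeta> - u \<zeta>))\<^sup>2 / c \<le> s / 4"
    by simp argo
  then have "(L2_norm (\<lambda>\<zeta>. g \<zeta> - u \<zeta>))\<^sup>2 \<le> (s / 4) * c"
    using c by (simp only: pos_divide_le_eq)
  also have "\<dots> < (\<epsilon> / 2)\<^sup>2"
    using s e by (simp add: c_def field_simps power2_eq_square)
  finally have "L2_norm (\<lambda>\<zeta>. g \<zeta> - u \<zeta>) < \<epsilon> / 2"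
    using e by (intro power2_less_imp_less[of _ "\<epsilon> / 2"]) auto
  then have "L2_norm (\<lambda>\<zeta>. f \<zeta> - u \<zeta>) < \<epsilon>"
    using fg L2_triangle[OF f dom_L2[OF g] dom_L2[OF uF]] by linarith
  then show "\<exists>u\<in>Domain generator. L2_norm (\<lambda>\<zeta>. f \<zeta> - u \<zeta>) < \<epsilon>"
    using u by blast
qed

lemma generator_symmetric:
  assumes "(f, h) \<in> generator" "(u, v) \<in> generator"
  shows "L2_inner v f = L2_inner u h"
proof -
  have F: "f \<in> F" "h \<in> L2_circle" "u \<in> F" "v \<in> L2_circle"
    and "E u f = L2_inner v f" "E f u = L2_inner h u"
    using assms by (auto simp: generator_def)
  then show ?thesis
    using sym[of f u] L2.sym[of h u] dom_L2 by simp
qed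

text \<open>If \<open>(f, h)\<close> lies in the adjoint and \<open>u\<close> solves \<open>u + G u = f + h\<close>, then \<open>f - u\<close> is
  orthogonal to the range of \<open>1 + G\<close>, which is everything; so \<open>f = u\<close> almost everywhere.\<close>

lemma generator_selfadjoint: "L2_adjoint generator = generator"
proof (intro subset_antisym subrelI)
  fix f h assume fh: "(f, h) \<in> generator"
  then have "f \<in> L2_circle" "h \<in> L2_circle"
    by (auto simp: generator_def dom_L2)
  then show "(f, h) \<in> L2_adjoint generator"
    unfolding L2_adjoint_def by (auto intro: generator_symmetric[OF fh])
next
  fix f h assume "(f, h) \<in> L2_adjoint generator"
  then have f: "f \<in> L2_circle" and h: "h \<in> L2_circle"
    and adj: "\<And>u v. (u, v) \<in> generator \<Longrightarrow> L2_inner v f = L2_inner u h"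
    by (auto simp: L2_adjoint_def)
  let ?s = "\<lambda>\<zeta>. f \<zeta> + h \<zeta>"
  obtain u where u: "(u, \<lambda>\<zeta>. ?s \<zeta> - u \<zeta>) \<in> generator"
    using generator_resolvent_exists[of 1 ?s] L2.add_dom[OF f h] by auto
  then have uF: "u \<in> F" and u2: "u \<in> L2_circle" by (auto simp: generator_def dom_L2)
  have "L2_inner w (\<lambda>\<zeta>. f \<zeta> - u \<zeta>) = 0" if w: "w \<in> L2_circle" for w
  proof -
    obtain v where v: "(v, \<lambda>\<zeta>. w \<zeta> - v \<zeta>) \<in> generator"
      using generator_resolvent_exists[of 1 w] w by auto
    then have v2: "v \<in> L2_circle" by (auto simp: generator_def dom_L2)
    have "L2_inner w f = L2_inner v f + L2_inner v h"
      using adj[OF v] w v2 f by (simp add: L2.diff_left diff_eq_eq add.commute)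
    moreover have "L2_inner w u - L2_inner v u = L2_inner v f + L2_inner v h - L2_inner v u"
      using generator_symmetric[OF u v] w v2 f h u2 by (simp add: L2.form_simps)
    ultimately show ?thesis
      using w f u2 by (simp add: L2.diff_right)
  qed
  then have "AE \<zeta> in circle_measure. f \<zeta> - u \<zeta> = 0"
    using f u2 by (intro L2_norm_zero_imp_AE) (auto simp: L2.diff_dom L2_norm_conv_inner)
  then have ae: "AE \<zeta> in circle_measure. u \<zeta> = f \<zeta>"
    by eventually_elim simp
  have "E f g = L2_inner h g" if g: "g \<in> F" for g
  proof -
    have "E f g = E u g" by (rule cong_left[OF uF f ae g])
    also have "\<dots> = L2_inner (\<lambda>\<zeta>. ?s \<zeta> - u \<zeta>) g"
      using u g by (simp add: generator_def)
    also have "\<dots> = L2_inner f g + L2_inner h g - L2_inner u g"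
      using f h u2 g by (simp add: L2.form_simps dom_L2)
    finally show ?thesis
      using L2.cong_left[OF u2 f ae dom_L2[OF g]] by simp
  qed
  then show "(f, h) \<in> generator"
    using cong_dom[OF uF f ae] h by (simp add: generator_def)
qed

text \<open>Every symmetric operator representing the form is a restriction of \<open>generator\<close>, and taking
  adjoints reverses inclusions, so a self-adjoint one equals \<open>generator\<close>.\<close>

lemma form_generator_eq: "form_generator E F = generator"
  unfolding form_generator_def
proof (rule the_equality)
  have nonneg_gen: "0 \<le> Re (L2_inner h f)" if "(f, h) \<in> generator" for f h
  proof -
    have "f \<in> F" "E f f = L2_inner h f" using that by (auto simp: generator_def)
    then show ?thesis using nonneg[of f] by simp
  qed
  have "generator \<subseteq> L2_circle \<times> L2_circle"
    using dom_L2 by (auto simp: generator_def)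
  then have "nonneg_selfadjoint generator"
    unfolding nonneg_selfadjoint_def
    using generator_domain_dense generator_selfadjoint nonneg_gen by blast
  moreover have "\<forall>(f, h)\<in>generator. f \<in> F \<and> (\<forall>g\<in>F. E f g = L2_inner h g)"
    unfolding generator_def by blast
  ultimately show "nonneg_selfadjoint generator \<and> (\<forall>(f, h)\<in>generator. f \<in> F \<and> (\<forall>g\<in>F. E f g = L2_inner h g))"
    by (rule conjI)
next
  fix G assume G: "nonneg_selfadjoint G \<and> (\<forall>(f, h)\<in>G. f \<in> F \<and> (\<forall>g\<in>F. E f g = L2_inner h g))"
  then have GL2: "G \<subseteq> L2_circle \<times> L2_circle" and Gadj: "L2_adjoint G = G"
    by (simp_all add: nonneg_selfadjoint_def)
  have sub: "G \<subseteq> generator"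
  proof (rule subrelI)
    fix f h assume fh: "(f, h) \<in> G"
    then have "f \<in> F \<and> (\<forall>g\<in>F. E f g = L2_inner h g)" using G by blast
    then show "(f, h) \<in> generator" using fh GL2 by (auto simp: generator_def)
  qed
  then have "L2_adjoint generator \<subseteq> L2_adjoint G"
    unfolding L2_adjoint_def by blast
  then have "generator \<subseteq> G"
    by (simp only: Gadj generator_selfadjoint)
  then show "G = generator" using sub by (intro subset_antisym)
qed

lemma form_resolvent_solves:
  assumes f: "f \<in> L2_circle"
  defines "u \<equiv> form_resolvent E F f"
  shows "u \<in> F" "g \<in> F \<Longrightarrow> E u g + L2_inner u g = L2_inner f g"
proof -
  let ?P = "\<lambda>u. \<exists>h. (u, h) \<in> generator \<and> (AE \<zeta> in circle_measure. u \<zeta> + h \<zeta> = f \<zeta>)"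
  obtain w where "(w, \<lambda>\<zeta>. f \<zeta> - w \<zeta>) \<in> generator"
    using generator_resolvent_exists[of 1 f] f by auto
  then have "?P w" by (intro exI[of _ "\<lambda>\<zeta>. f \<zeta> - w \<zeta>"]) simp
  then have "?P u"
    unfolding u_def form_resolvent_def form_generator_eq by (rule someI[of ?P w])
  then obtain h where uh: "(u, h) \<in> generator" and ae: "AE \<zeta> in circle_measure. u \<zeta> + h \<zeta> = f \<zeta>"
    by blast
  then show uF: "u \<in> F" by (simp add: generator_def)
  assume g: "g \<in> F"
  have h: "h \<in> L2_circle" using uh by (simp add: generator_def)
  have "E u g + L2_inner u g = L2_inner (\<lambda>\<zeta>. u \<zeta> + h \<zeta>) g"
    using uh g h uF by (simp add: generator_def L2.add_left dom_L2)
  also have "\<dots> = L2_inner f g"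
    by (rule L2.cong_left[OF L2.add_dom[OF dom_L2[OF uF] h] f ae dom_L2[OF g], symmetric])
  finally show "E u g + L2_inner u g = L2_inner f g" .
qed

lemma variational_solution_unique:
  assumes u: "u \<in> F" and v: "v \<in> F"
    and eq: "\<And>g. g \<in> F \<Longrightarrow> E u g + L2_inner u g = E v g + L2_inner v g"
  shows "AE \<zeta> in circle_measure. u \<zeta> = v \<zeta>"
proof -
  let ?d = "\<lambda>\<zeta>. u \<zeta> - v \<zeta>"
  have d: "?d \<in> F" using u v by (rule diff_dom)
  have "E ?d ?d + L2_inner ?d ?d = 0"
    using eq[OF d] u v d by (simp add: diff_left L2.diff_left dom_L2 algebra_simps)
  then have "Re (E ?d ?d) + (L2_norm ?d)\<^sup>2 = 0"
    unfolding L2_inner_self by (metis Re_complex_of_real plus_complex.sel(1) zero_complex.sel(1))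
  then have "L2_norm ?d = 0"
    using nonneg[OF d] by (simp add: add_nonneg_eq_0_iff)
  then have "AE \<zeta> in circle_measure. ?d \<zeta> = 0"
    by (rule L2_norm_zero_imp_AE[OF dom_L2[OF d]])
  then show ?thesis by simp
qed

end

section \<open>The Cauchy transform\<close>

definition cauchy_transform :: "(complex \<Rightarrow> complex) \<Rightarrow> complex \<Rightarrow> complex" where
  "cauchy_transform g z = L2_inner g (\<lambda>\<zeta>. szego_kernel \<zeta> z)"

text \<open>An absolutely convergent power series converges uniformly on the circle and may be integrated
  term by term. This covers both the Szego kernel and the dilations of a function holomorphic in
  the disc.\<close>

lemma power_series_L2_inner:
  assumes c: "summable (\<lambda>n. cmod (c n))" and g: "g \<in> L2_circle"
    and f: "\<And>\<zeta>. cmod \<zeta> = 1 \<Longrightarrow> (\<lambda>n. c n * \<zeta> ^ n) sums f \<zeta>"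
  shows "(\<lambda>n. c n * L2_inner (\<lambda>\<zeta>. \<zeta> ^ n) g) sums L2_inner f g"
proof -
  let ?t = "\<lambda>n \<zeta>. c n * (\<zeta> ^ n * cnj (g \<zeta>))"
  have int: "integrable circle_measure (?t n)" for n
    by (intro integrable_mult_right L2_product_integrable L2_power g)
  have nrm: "norm (?t n \<zeta>) = cmod (c n) * cmod (g \<zeta>)" if "cmod \<zeta> = 1" for n \<zeta>
    using that by (simp add: norm_mult norm_power)
  have "(\<lambda>n. LINT \<zeta>|circle_measure. ?t n \<zeta>) sums (LINT \<zeta>|circle_measure. (\<Sum>n. ?t n \<zeta>))"
  proof (rule sums_integral[OF int])
    show "AE \<zeta> in circle_measure. summable (\<lambda>n. norm (?t n \<zeta>))"
      by (intro AE_I2) (simp add: nrm summable_mult2 c)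
    have "(LINT \<zeta>|circle_measure. norm (?t n \<zeta>)) = cmod (c n) * (LINT \<zeta>|circle_measure. cmod (g \<zeta>))" for n
      by (subst integral_mult_right_zero[symmetric], rule Bochner_Integration.integral_cong) (auto simp: nrm)
    then show "summable (\<lambda>n. LINT \<zeta>|circle_measure. norm (?t n \<zeta>))"
      by (simp add: summable_mult2 c)
  qed
  moreover have "(LINT \<zeta>|circle_measure. (\<Sum>n. ?t n \<zeta>)) = L2_inner f g"
    unfolding L2_inner_def
  proof (rule Bochner_Integration.integral_cong)
    fix \<zeta> assume "\<zeta> \<in> space circle_measure"
    then have "(\<lambda>n. c n * \<zeta> ^ n * cnj (g \<zeta>)) sums (f \<zeta> * cnj (g \<zeta>))"
      by (intro sums_mult2 f) simp
    then show "(\<Sum>n. ?t n \<zeta>) = f \<zeta> * cnj (g \<zeta>)"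
      by (simp add: sums_iff mult.assoc)
  qed simp
  ultimately show ?thesis by (simp add: L2_inner_def)
qed

lemma szego_in_L2:
  assumes "cmod z < 1"
  shows "(\<lambda>\<zeta>. szego_kernel \<zeta> z) \<in> L2_circle"
proof -
  have "1 - cnj z * \<zeta> \<noteq> 0" if "cmod \<zeta> = 1" for \<zeta>
  proof
    assume "1 - cnj z * \<zeta> = 0"
    then have "cmod (cnj z * \<zeta>) = 1" by (metis eq_iff_diff_eq_0 norm_one)
    then show False using assms that by (simp add: norm_mult)
  qed
  then show ?thesis
    unfolding szego_kernel_def by (intro continuous_in_L2 continuous_intros) auto
qed

lemma cauchy_transform_sums:
  assumes z: "cmod z < 1" and g: "g \<in> L2_circle"
  shows "(\<lambda>n. L2_inner g (\<lambda>\<zeta>. \<zeta> ^ n) * z ^ n) sums cauchy_transform g z"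
proof -
  have "(\<lambda>n. cnj z ^ n * L2_inner (\<lambda>\<zeta>. \<zeta> ^ n) g) sums L2_inner (\<lambda>\<zeta>. szego_kernel \<zeta> z) g"
  proof (rule power_series_L2_inner[OF _ g])
    show "summable (\<lambda>n. cmod (cnj z ^ n))"
      using z by (simp add: norm_power summable_geometric)
    fix \<zeta> :: complex assume "cmod \<zeta> = 1"
    then have "(\<lambda>n. (cnj z * \<zeta>) ^ n) sums (1 / (1 - cnj z * \<zeta>))"
      using z by (intro geometric_sums) (simp add: norm_mult)
    then show "(\<lambda>n. cnj z ^ n * \<zeta> ^ n) sums szego_kernel \<zeta> z"
      by (simp add: szego_kernel_def power_mult_distrib)
  qed
  then have "(\<lambda>n. cnj (cnj z ^ n * L2_inner (\<lambda>\<zeta>. \<zeta> ^ n) g)) sums cnj (L2_inner (\<lambda>\<zeta>. szego_kernel \<zeta> z) g)"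
    by (simp only: sums_cnj)
  then show ?thesis
    using L2.sym[OF L2_power g] L2.sym[OF szego_in_L2[OF z] g]
    by (simp add: cauchy_transform_def mult.commute)
qed

lemma cauchy_transform_holomorphic:
  assumes "g \<in> L2_circle"
  shows "cauchy_transform g holomorphic_on ball 0 1"
  by (rule power_series_holomorphic[where a="\<lambda>n. L2_inner g (\<lambda>\<zeta>. \<zeta> ^ n)"])
     (use cauchy_transform_sums assms in auto)

section \<open>Boundary functions of the Hardy space\<close>

lemma power_series_dilation_summable:
  assumes f: "\<And>z. z \<in> ball 0 1 \<Longrightarrow> (\<lambda>n. a n * z ^ n) sums f z" and r: "0 \<le> r" "r < 1"
  shows "summable (\<lambda>n. cmod (a n * of_real r ^ n))"
proof -
  have "summable (\<lambda>n. a n * of_real ((r + 1) / 2) ^ n)"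
    using f[of "of_real ((r + 1) / 2)"] r by (auto simp: sums_iff norm_of_real)
  then show ?thesis
    by (rule powser_insidea) (use r in \<open>simp del: of_real_add of_real_divide\<close>)
qed

lemma power_series_dilation_sums:
  assumes f: "\<And>z. z \<in> ball 0 1 \<Longrightarrow> (\<lambda>n. a n * z ^ n) sums f z" and r: "0 \<le> r" "r < 1"
    and \<zeta>: "cmod \<zeta> = 1"
  shows "(\<lambda>n. (a n * of_real r ^ n) * \<zeta> ^ n) sums f (of_real r * \<zeta>)"
  using f[of "of_real r * \<zeta>"] r \<zeta> by (simp add: norm_mult power_mult_distrib mult.assoc)

lemma dilation_in_L2:
  assumes "f holomorphic_on ball 0 1" "0 \<le> r" "r < 1"
  shows "(\<lambda>\<zeta>. f (of_real r * \<zeta>)) \<in> L2_circle"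
proof (intro continuous_in_L2 continuous_on_compose2[OF holomorphic_on_imp_continuous_on[OF assms(1)]])
  show "(\<lambda>\<zeta>. complex_of_real r * \<zeta>) ` sphere 0 1 \<subseteq> ball 0 1"
    using assms by (auto simp: norm_mult)
qed (intro continuous_intros)

lemma L2_inner_power_power: "L2_inner (\<lambda>\<zeta>. \<zeta> ^ n) (\<lambda>\<zeta>. \<zeta> ^ m) = (if n = m then 1 else 0)"
  using circle_power_orthogonal[of n m] by (simp add: L2_inner_def)

lemma L2_inner_power_cnj_power:
  "m > 0 \<Longrightarrow> L2_inner (\<lambda>\<zeta>. \<zeta> ^ n) (\<lambda>\<zeta>. cnj \<zeta> ^ m) = 0"
  using circle_integral_power[of "n + m"] by (simp add: L2_inner_def power_add)

context
  fixes f :: "complex \<Rightarrow> complex" and a :: "nat \<Rightarrow> complex"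
  assumes series: "\<And>z. z \<in> ball 0 1 \<Longrightarrow> (\<lambda>n. a n * z ^ n) sums f z"
begin

lemma dilation_L2_inner_sums:
  assumes "0 \<le> r" "r < 1" "g \<in> L2_circle"
  shows "(\<lambda>n. a n * of_real r ^ n * L2_inner (\<lambda>\<zeta>. \<zeta> ^ n) g) sums L2_inner (\<lambda>\<zeta>. f (of_real r * \<zeta>)) g"
  using power_series_dilation_summable[OF series assms(1,2)] power_series_dilation_sums[OF series assms(1,2)]
    assms(3) by (intro power_series_L2_inner) auto

lemma series_holomorphic: "f holomorphic_on ball 0 1"
  by (rule power_series_holomorphic[where a=a]) (use series in simp)

lemma dilation_coefficient:
  assumes "0 \<le> r" "r < 1"
  shows "L2_inner (\<lambda>\<zeta>. f (of_real r * \<zeta>)) (\<lambda>\<zeta>. \<zeta> ^ m) = a m * of_real r ^ m"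
proof -
  have "(\<lambda>n. a n * of_real r ^ n * L2_inner (\<lambda>\<zeta>. \<zeta> ^ n) (\<lambda>\<zeta>. \<zeta> ^ m)) =
      (\<lambda>n. if n = m then a n * of_real r ^ n else 0)"
    by (auto simp: L2_inner_power_power)
  with dilation_L2_inner_sums[OF assms L2_power[of m]]
  have "(\<lambda>n. if n = m then a n * of_real r ^ n else 0) sums L2_inner (\<lambda>\<zeta>. f (of_real r * \<zeta>)) (\<lambda>\<zeta>. \<zeta> ^ m)"
    by (simp only:)
  then show ?thesis
    by (rule sums_unique2) (rule sums_single)
qed

lemma dilation_negative_coefficient:
  assumes "0 \<le> r" "r < 1" "m > 0"
  shows "L2_inner (\<lambda>\<zeta>. f (of_real r * \<zeta>)) (\<lambda>\<zeta>. cnj \<zeta> ^ m) = 0"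
proof (rule sums_unique2)
  show "(\<lambda>n. 0) sums L2_inner (\<lambda>\<zeta>. f (of_real r * \<zeta>)) (\<lambda>\<zeta>. cnj \<zeta> ^ m)"
    using dilation_L2_inner_sums[OF assms(1,2) L2_cnj_power[of m]]
    by (simp only: L2_inner_power_cnj_power[OF assms(3)] mult_zero_right)
qed simp

text \<open>By Parseval, \<open>mean_square t\<close> is the mean of \<open>\<bar>f\<bar>\<^sup>2\<close> over the circle of radius \<open>sqrt t\<close>.\<close>

definition mean_square :: "real \<Rightarrow> real" where
  "mean_square t = (\<Sum>n. (cmod (a n))\<^sup>2 * t ^ n)"

lemma dilation_L2_inner:
  assumes r: "0 \<le> r" "r < 1" and s: "0 \<le> s" "s < 1"
  shows "(\<lambda>n. (cmod (a n))\<^sup>2 * (r * s) ^ n) sums mean_square (r * s)"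
    and "L2_inner (\<lambda>\<zeta>. f (of_real r * \<zeta>)) (\<lambda>\<zeta>. f (of_real s * \<zeta>)) = of_real (mean_square (r * s))"
proof -
  let ?fs = "\<lambda>\<zeta>. f (of_real s * \<zeta>)"
  have fs: "?fs \<in> L2_circle" by (rule dilation_in_L2[OF series_holomorphic s])
  have "L2_inner (\<lambda>\<zeta>. \<zeta> ^ n) ?fs = cnj (a n) * of_real s ^ n" for n
    using L2.sym[OF fs L2_power[of n]] dilation_coefficient[OF s, of n] by simp
  then have "(\<lambda>n. a n * of_real r ^ n * (cnj (a n) * of_real s ^ n)) sums L2_inner (\<lambda>\<zeta>. f (of_real r * \<zeta>)) ?fs"
    using dilation_L2_inner_sums[OF r fs] by simp
  also have "(\<lambda>n. a n * of_real r ^ n * (cnj (a n) * of_real s ^ n)) =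
      (\<lambda>n. of_real ((cmod (a n))\<^sup>2 * (r * s) ^ n))"
    unfolding of_real_mult complex_norm_square by (simp add: power_mult_distrib mult_ac)
  finally have sums: "(\<lambda>n. of_real ((cmod (a n))\<^sup>2 * (r * s) ^ n)) sums L2_inner (\<lambda>\<zeta>. f (of_real r * \<zeta>)) ?fs" .
  then have "summable (\<lambda>n. complex_of_real ((cmod (a n))\<^sup>2 * (r * s) ^ n))"
    by (rule sums_summable)
  then have "summable (\<lambda>n. (cmod (a n))\<^sup>2 * (r * s) ^ n)"
    by (simp only: summable_of_real_iff)
  then show 1: "(\<lambda>n. (cmod (a n))\<^sup>2 * (r * s) ^ n) sums mean_square (r * s)"
    unfolding mean_square_def by (rule summable_sums)
  show "L2_inner (\<lambda>\<zeta>. f (of_real r * \<zeta>)) ?fs = of_real (mean_square (r * s))"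
    by (rule sums_unique2[OF sums sums_of_real[OF 1]])
qed

lemma dilation_L2_norm:
  assumes "0 \<le> r" "r < 1"
  shows "(L2_norm (\<lambda>\<zeta>. f (of_real r * \<zeta>)))\<^sup>2 = mean_square (r\<^sup>2)"
  using dilation_L2_inner(2)[OF assms assms] unfolding L2_inner_self of_real_eq_iff power2_eq_square[of r] .

lemma mean_square_mono:
  assumes "0 \<le> s" "s \<le> t" "t < 1"
  shows "mean_square s \<le> mean_square t"
proof -
  have sums: "(\<lambda>n. (cmod (a n))\<^sup>2 * x ^ n) sums mean_square x" if "0 \<le> x" "x < 1" for x
    using dilation_L2_inner(1)[of "sqrt x" "sqrt x"] that by simp
  show ?thesis
  proof (rule sums_le)
    show "(cmod (a n))\<^sup>2 * s ^ n \<le> (cmod (a n))\<^sup>2 * t ^ n" for n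
      using assms by (intro mult_left_mono power_mono) auto
  qed (use assms in \<open>auto intro!: sums\<close>)
qed

lemma dilation_diff_L2_norm:
  assumes r: "0 \<le> r" "r < 1" and s: "0 \<le> s" "s < 1"
  shows "(L2_norm (\<lambda>\<zeta>. f (of_real r * \<zeta>) - f (of_real s * \<zeta>)))\<^sup>2 =
    mean_square (r\<^sup>2) + mean_square (s\<^sup>2) - 2 * mean_square (r * s)"
proof -
  let ?f = "\<lambda>r \<zeta>. f (of_real r * \<zeta>)"
  have L2: "?f r \<in> L2_circle" "?f s \<in> L2_circle"
    by (rule dilation_in_L2[OF series_holomorphic r], rule dilation_in_L2[OF series_holomorphic s])
  have "Re (L2_inner (\<lambda>\<zeta>. ?f r \<zeta> + (-1) * ?f s \<zeta>) (\<lambda>\<zeta>. ?f r \<zeta> + (-1) * ?f s \<zeta>)) =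
      mean_square (r * r) + 2 * Re (cnj (-1) * of_real (mean_square (r * s))) + (cmod (-1))\<^sup>2 * mean_square (s * s)"
    unfolding L2.quadratic_add[OF L2]
      dilation_L2_inner(2)[OF r r] dilation_L2_inner(2)[OF s s] dilation_L2_inner(2)[OF r s] by simp
  then show ?thesis
    unfolding L2_inner_self Re_complex_of_real by (simp add: power2_eq_square)
qed

text \<open>The dilations satisfy \<open>\<langle>f\<^sub>r, f\<^sub>s\<rangle> = mean_square (r s)\<close>, and \<open>mean_square\<close> increases to a
  finite limit, so \<open>\<parallel>f\<^sub>r - f\<^sub>s\<parallel>\<^sup>2\<close> tends to \<open>0\<close> when \<open>r\<close> and \<open>s\<close> tend to \<open>1\<close>.\<close>

lemma dilations_cauchy:
  assumes f: "f \<in> hardy2" and e: "\<epsilon> > 0"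
  obtains \<rho> where "0 \<le> \<rho>" "\<rho> < 1"
    "\<And>r s. \<rho> \<le> r \<Longrightarrow> r < 1 \<Longrightarrow> \<rho> \<le> s \<Longrightarrow> s < 1 \<Longrightarrow>
      L2_norm (\<lambda>\<zeta>. f (of_real r * \<zeta>) - f (of_real s * \<zeta>)) < \<epsilon>"
proof -
  define S where "S = Sup (mean_square ` {0..<1})"
  obtain B where "\<forall>r\<in>{0..<1}. (LINT \<zeta>|circle_measure. (cmod (f (of_real r * \<zeta>)))\<^sup>2) \<le> B"
    using f unfolding hardy2_def bdd_above_def by auto
  then have B: "(LINT \<zeta>|circle_measure. (cmod (f (of_real r * \<zeta>)))\<^sup>2) \<le> B" if "0 \<le> r" "r < 1" for r
    using that by simp
  have "mean_square t \<le> B" if "0 \<le> t" "t < 1" for t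
  proof -
    have "mean_square t = (L2_norm (\<lambda>\<zeta>. f (of_real (sqrt t) * \<zeta>)))\<^sup>2"
      using dilation_L2_norm[of "sqrt t"] that by simp
    also have "\<dots> \<le> B"
      using B[of "sqrt t"] that by (simp add: L2_norm_def)
    finally show ?thesis .
  qed
  then have bdd: "bdd_above (mean_square ` {0..<1})"
    by (auto intro!: bdd_aboveI[of _ B])
  then have le_S: "mean_square t \<le> S" if "0 \<le> t" "t < 1" for t
    unfolding S_def using that by (auto intro: cSup_upper)
  have "S - \<epsilon>\<^sup>2 / 4 < S" using e by simp
  then have "\<exists>t\<in>{0..<1}. S - \<epsilon>\<^sup>2 / 4 < mean_square t"
    unfolding S_def by (subst (asm) less_cSup_iff[OF _ bdd]) auto
  then obtain t where t: "0 \<le> t" "t < 1" "S - \<epsilon>\<^sup>2 / 4 < mean_square t"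
    by auto
  show thesis
  proof (rule that[of "sqrt t"])
    fix r s assume r: "sqrt t \<le> r" "r < 1" and s: "sqrt t \<le> s" "s < 1"
    have pos: "0 \<le> r" "0 \<le> s" using r s t(1) order_trans[OF real_sqrt_ge_zero] by auto
    have "sqrt t * sqrt t \<le> r * s" using r s t(1) pos by (intro mult_mono) auto
    then have "t \<le> r * s" using t(1) by simp
    moreover have lt: "x * y < 1" if "0 \<le> x" "x < 1" "0 \<le> y" "y < 1" for x y :: real
      using mult_strict_mono'[of x 1 y 1] that by simp
    ultimately have "mean_square t \<le> mean_square (r * s)"
      using t(1) lt[OF pos(1) r(2) pos(2) s(2)] by (intro mean_square_mono)
    moreover have "mean_square (r\<^sup>2) \<le> S" "mean_square (s\<^sup>2) \<le> S"
      using lt[OF pos(1) r(2) pos(1) r(2)] lt[OF pos(2) s(2) pos(2) s(2)]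
      by (auto intro!: le_S simp: power2_eq_square)
    ultimately have "(L2_norm (\<lambda>\<zeta>. f (of_real r * \<zeta>) - f (of_real s * \<zeta>)))\<^sup>2 < \<epsilon>\<^sup>2"
      unfolding dilation_diff_L2_norm[OF pos(1) r(2) pos(2) s(2)]
      using t(3) e zero_less_power[OF e, of 2] by linarith
    then show "L2_norm (\<lambda>\<zeta>. f (of_real r * \<zeta>) - f (of_real s * \<zeta>)) < \<epsilon>"
      using e by (intro power2_less_imp_less[of _ \<epsilon>]) auto
  qed (use t in auto)
qed

text \<open>Completeness applies to the sequence of dilations with radii \<open>1 - 1 / (n + 1)\<close>; the Cauchy
  estimate then compares an arbitrary radius with one from the sequence.\<close>

lemma boundary_function_exists:
  assumes f: "f \<in> hardy2"
  shows "\<exists>b. b \<in> L2_circle \<and>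
    ((\<lambda>r. L2_norm (\<lambda>\<zeta>. f (of_real r * \<zeta>) - b \<zeta>)) \<longlongrightarrow> 0) (at_left (1::real))"
proof -
  let ?f = "\<lambda>r \<zeta>. f (complex_of_real r * \<zeta>)"
  have fL2: "?f r \<in> L2_circle" if "0 \<le> r" "r < 1" for r
    by (rule dilation_in_L2[OF series_holomorphic that])
  define q where "q n = 1 - 1 / real (Suc n)" for n
  have q: "0 \<le> q n" "q n < 1" for n by (simp_all add: q_def)
  have q_lim: "q \<longlonglongrightarrow> 1"
  proof -
    have "(\<lambda>n. 1 - 1 / real (Suc n)) \<longlonglongrightarrow> 1 - 0"
      by (intro tendsto_diff tendsto_const LIMSEQ_Suc[OF lim_1_over_n])
    then show ?thesis by (simp add: q_def[abs_def])
  qed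
  have q_ge: "\<forall>\<^sub>F n in sequentially. \<rho> \<le> q n" if "\<rho> < 1" for \<rho>
    using order_tendstoD(1)[OF q_lim that] by eventually_elim simp
  have "\<exists>b\<in>L2_circle. (\<lambda>n. L2_norm (\<lambda>\<zeta>. ?f (q n) \<zeta> - b \<zeta>)) \<longlonglongrightarrow> 0"
  proof (rule L2_complete)
    fix e :: real assume "e > 0"
    obtain \<rho> where \<rho>: "0 \<le> \<rho>" "\<rho> < 1" and c: "\<And>r s. \<rho> \<le> r \<Longrightarrow> r < 1 \<Longrightarrow> \<rho> \<le> s \<Longrightarrow> s < 1 \<Longrightarrow>
        L2_norm (\<lambda>\<zeta>. ?f r \<zeta> - ?f s \<zeta>) < e"
      by (rule dilations_cauchy[OF f \<open>e > 0\<close>]) (rule that)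
    obtain N where N: "\<And>n. n \<ge> N \<Longrightarrow> \<rho> \<le> q n"
      using q_ge[OF \<rho>(2)] by (auto simp: eventually_sequentially)
    then show "\<exists>N. \<forall>m\<ge>N. \<forall>n\<ge>N. L2_norm (\<lambda>\<zeta>. ?f (q m) \<zeta> - ?f (q n) \<zeta>) < e"
      by (intro exI[of _ N] allI impI c N q(2))
  qed (rule fL2[OF q])
  then obtain b where b: "b \<in> L2_circle" and lim: "(\<lambda>n. L2_norm (\<lambda>\<zeta>. ?f (q n) \<zeta> - b \<zeta>)) \<longlonglongrightarrow> 0"
    by blast
  have "((\<lambda>r. L2_norm (\<lambda>\<zeta>. ?f r \<zeta> - b \<zeta>)) \<longlongrightarrow> 0) (at_left (1::real))"
  proof (rule tendstoI)
    fix e :: real assume e: "e > 0"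
    obtain \<rho> where \<rho>: "0 \<le> \<rho>" "\<rho> < 1" and c: "\<And>r s. \<rho> \<le> r \<Longrightarrow> r < 1 \<Longrightarrow> \<rho> \<le> s \<Longrightarrow> s < 1 \<Longrightarrow>
        L2_norm (\<lambda>\<zeta>. ?f r \<zeta> - ?f s \<zeta>) < e / 2"
      by (rule dilations_cauchy[OF f half_gt_zero[OF e]]) (rule that)
    have "\<forall>\<^sub>F n in sequentially. L2_norm (\<lambda>\<zeta>. ?f (q n) \<zeta> - b \<zeta>) < e / 2"
      using order_tendstoD(2)[OF lim half_gt_zero[OF e]] .
    with q_ge[OF \<rho>(2)] have "\<forall>\<^sub>F n in sequentially. \<rho> \<le> q n \<and> L2_norm (\<lambda>\<zeta>. ?f (q n) \<zeta> - b \<zeta>) < e / 2"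
      by (rule eventually_conj)
    then obtain n where n: "\<rho> \<le> q n" "L2_norm (\<lambda>\<zeta>. ?f (q n) \<zeta> - b \<zeta>) < e / 2"
      using eventually_happens'[OF sequentially_bot] by blast
    have "\<forall>\<^sub>F r in at_left (1::real). \<rho> < r \<and> r < 1"
      using \<rho>(2) eventually_at_left_field by blast
    then show "\<forall>\<^sub>F r in at_left (1::real). dist (L2_norm (\<lambda>\<zeta>. ?f r \<zeta> - b \<zeta>)) 0 < e"
    proof eventually_elim
      case (elim r)
      then have r: "0 \<le> r" "r < 1" "\<rho> \<le> r" using \<rho> by auto
      have "L2_norm (\<lambda>\<zeta>. ?f r \<zeta> - b \<zeta>) < e"
        using L2_triangle[OF fL2[OF r(1,2)] fL2[OF q[of n]] b] c[OF r(3,2) n(1) q(2)] n(2) by linarith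
      then show ?case by simp
    qed
  qed
  then show ?thesis using b by blast
qed

end

lemma holomorphic_power_series_at_0:
  assumes "f holomorphic_on ball 0 1"
  obtains a where "\<And>z. z \<in> ball 0 1 \<Longrightarrow> (\<lambda>n. a n * z ^ n) sums f z"
  by (rule that[of "\<lambda>n. (deriv ^^ n) f 0 / fact n"]) (use holomorphic_power_series[OF assms] in force)

lemma hardy2_holomorphic: "f \<in> hardy2 \<Longrightarrow> f holomorphic_on ball 0 1"
  by (simp add: hardy2_def)

lemma
  assumes f: "f \<in> hardy2"
  shows boundary_function_L2: "boundary_function f \<in> L2_circle"
    and boundary_function_tendsto:
      "((\<lambda>r. L2_norm (\<lambda>\<zeta>. f (of_real r * \<zeta>) - boundary_function f \<zeta>)) \<longlongrightarrow> 0) (at_left (1::real))"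
proof -
  obtain a where "\<And>z. z \<in> ball 0 1 \<Longrightarrow> (\<lambda>n. a n * z ^ n) sums f z"
    using holomorphic_power_series_at_0 hardy2_holomorphic[OF f] by blast
  from someI_ex[OF boundary_function_exists[OF this f], folded boundary_function_def]
  show "boundary_function f \<in> L2_circle"
    "((\<lambda>r. L2_norm (\<lambda>\<zeta>. f (of_real r * \<zeta>) - boundary_function f \<zeta>)) \<longlongrightarrow> 0) (at_left (1::real))"
    by simp_all
qed

lemma dilation_inner_tendsto:
  assumes f: "f \<in> hardy2" and g: "g \<in> L2_circle"
  shows "((\<lambda>r. L2_inner (\<lambda>\<zeta>. f (of_real r * \<zeta>)) g) \<longlongrightarrow> L2_inner (boundary_function f) g) (at_left (1::real))"
proof (rule L2_inner_tendsto[OF _ boundary_function_L2[OF f] g boundary_function_tendsto[OF f]])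
  have "\<forall>\<^sub>F r in at_left (1::real). 0 < r \<and> r < 1"
    using eventually_at_left_field zero_less_one by blast
  then show "\<forall>\<^sub>F r in at_left (1::real). (\<lambda>\<zeta>. f (of_real r * \<zeta>)) \<in> L2_circle"
    by eventually_elim (use dilation_in_L2[OF hardy2_holomorphic[OF f]] in simp)
qed

lemma boundary_function_coefficient:
  assumes f: "f \<in> hardy2" and series: "\<And>z. z \<in> ball 0 1 \<Longrightarrow> (\<lambda>n. a n * z ^ n) sums f z"
  shows "L2_inner (boundary_function f) (\<lambda>\<zeta>. \<zeta> ^ m) = a m"
proof (rule tendsto_unique[OF _ dilation_inner_tendsto[OF f L2_power]])
  have "((\<lambda>r. a m * of_real r ^ m) \<longlongrightarrow> a m * of_real 1 ^ m) (at_left (1::real))"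
    by (intro tendsto_intros)
  moreover have "\<forall>\<^sub>F r in at_left (1::real). 0 < r \<and> r < 1"
    using eventually_at_left_field zero_less_one by blast
  then have "\<forall>\<^sub>F r in at_left (1::real). L2_inner (\<lambda>\<zeta>. f (of_real r * \<zeta>)) (\<lambda>\<zeta>. \<zeta> ^ m) = a m * of_real r ^ m"
    by eventually_elim (use dilation_coefficient[OF series] in simp)
  ultimately show "((\<lambda>r. L2_inner (\<lambda>\<zeta>. f (of_real r * \<zeta>)) (\<lambda>\<zeta>. \<zeta> ^ m)) \<longlongrightarrow> a m) (at_left (1::real))"
    by (subst tendsto_cong) simp_all
qed simp

lemma boundary_function_negative_coefficient:
  assumes f: "f \<in> hardy2" and m: "m > 0"
  shows "L2_inner (boundary_function f) (\<lambda>\<zeta>. cnj \<zeta> ^ m) = 0"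
proof (rule tendsto_unique[OF _ dilation_inner_tendsto[OF f L2_cnj_power]])
  obtain a where series: "\<And>z. z \<in> ball 0 1 \<Longrightarrow> (\<lambda>n. a n * z ^ n) sums f z"
    using holomorphic_power_series_at_0 hardy2_holomorphic[OF f] by blast
  have "\<forall>\<^sub>F r in at_left (1::real). 0 < r \<and> r < 1"
    using eventually_at_left_field zero_less_one by blast
  then have "\<forall>\<^sub>F r in at_left (1::real). L2_inner (\<lambda>\<zeta>. f (of_real r * \<zeta>)) (\<lambda>\<zeta>. cnj \<zeta> ^ m) = 0"
    by eventually_elim (use dilation_negative_coefficient[OF series] m in simp)
  then show "((\<lambda>r. L2_inner (\<lambda>\<zeta>. f (of_real r * \<zeta>)) (\<lambda>\<zeta>. cnj \<zeta> ^ m)) \<longlongrightarrow> 0) (at_left (1::real))"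
    by (rule tendsto_eventually)
qed simp

lemma cauchy_transform_boundary_function:
  assumes f: "f \<in> hardy2" and z: "z \<in> ball 0 1"
  shows "cauchy_transform (boundary_function f) z = f z"
proof -
  obtain a where series: "\<And>z. z \<in> ball 0 1 \<Longrightarrow> (\<lambda>n. a n * z ^ n) sums f z"
    using holomorphic_power_series_at_0 hardy2_holomorphic[OF f] by blast
  have "L2_inner (boundary_function f) (\<lambda>\<zeta>. \<zeta> ^ n) = a n" for n
    by (rule boundary_function_coefficient[OF f]) (rule series)
  then have "(\<lambda>n. a n * z ^ n) sums cauchy_transform (boundary_function f) z"
    using cauchy_transform_sums[OF _ boundary_function_L2[OF f], of z] z by simp
  then show ?thesis using series[OF z] sums_unique2 by blast
qed

text \<open>A boundary function is a limit of dilations, and each dilation is a convergent series of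
  powers.\<close>

lemma orthogonal_to_powers_imp_orthogonal_to_hardy2:
  assumes f: "f \<in> hardy2" and g: "g \<in> L2_circle" and orth: "\<And>n. L2_inner (\<lambda>\<zeta>. \<zeta> ^ n) g = 0"
  shows "L2_inner (boundary_function f) g = 0"
proof (rule tendsto_unique[OF _ dilation_inner_tendsto[OF f g]])
  obtain a where series: "\<And>z. z \<in> ball 0 1 \<Longrightarrow> (\<lambda>n. a n * z ^ n) sums f z"
    using holomorphic_power_series_at_0 hardy2_holomorphic[OF f] by blast
  have "\<forall>\<^sub>F r in at_left (1::real). 0 < r \<and> r < 1"
    using eventually_at_left_field zero_less_one by blast
  then have "\<forall>\<^sub>F r in at_left (1::real). L2_inner (\<lambda>\<zeta>. f (of_real r * \<zeta>)) g = 0"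
  proof eventually_elim
    case (elim r)
    then have "(\<lambda>n. 0) sums L2_inner (\<lambda>\<zeta>. f (of_real r * \<zeta>)) g"
      using dilation_L2_inner_sums[OF series _ _ g, of r] by (simp add: orth)
    then show ?case by (rule sums_unique2) simp
  qed
  then show "((\<lambda>r. L2_inner (\<lambda>\<zeta>. f (of_real r * \<zeta>)) g) \<longlongrightarrow> 0) (at_left (1::real))"
    by (rule tendsto_eventually)
qed simp

text \<open>The Cauchy transform acts on boundary values as the orthogonal projection onto \<open>H\<^sup>2\<close>:
  a function and the boundary values of its Cauchy transform have the same Fourier
  coefficients of nonnegative index.\<close>

lemma L2_inner_boundary_function_cauchy_transform:
  assumes f: "f \<in> hardy2" and g: "g \<in> L2_circle" and h: "cauchy_transform g \<in> hardy2"
  shows "L2_inner (boundary_function f) (boundary_function (cauchy_transform g)) =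
    L2_inner (boundary_function f) g"
proof -
  let ?b = "boundary_function (cauchy_transform g)"
  have b: "?b \<in> L2_circle" by (rule boundary_function_L2[OF h])
  have "L2_inner ?b (\<lambda>\<zeta>. \<zeta> ^ n) = L2_inner g (\<lambda>\<zeta>. \<zeta> ^ n)" for n
    by (rule boundary_function_coefficient[OF h]) (use cauchy_transform_sums[OF _ g] in simp)
  then have "L2_inner (\<lambda>\<zeta>. \<zeta> ^ n) (\<lambda>\<zeta>. ?b \<zeta> - g \<zeta>) = 0" for n
    using L2.sym[OF b L2_power] L2.sym[OF g L2_power] b g by (simp add: L2.diff_right)
  then have "L2_inner (boundary_function f) (\<lambda>\<zeta>. ?b \<zeta> - g \<zeta>) = 0"
    by (rule orthogonal_to_powers_imp_orthogonal_to_hardy2[OF f L2.diff_dom[OF b g]])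
  then show ?thesis
    using b g boundary_function_L2[OF f] by (simp add: L2.diff_right)
qed

section \<open>Poisson extensions and their energy\<close>

lemma poisson_kernel_eq:
  assumes \<zeta>: "cmod \<zeta> = 1" and z: "cmod z < 1"
  shows "of_real ((1 - (cmod z)\<^sup>2) / (cmod (\<zeta> - z))\<^sup>2) = cnj (szego_kernel \<zeta> z) + szego_kernel \<zeta> z - 1"
proof -
  define w where "w = cnj z * \<zeta>"
  have cw: "cmod w = cmod z" using \<zeta> by (simp add: w_def norm_mult)
  have "w \<noteq> 1" using cw z by auto
  define p q where "p = 1 - w" and "q = 1 - cnj w"
  have nz: "p \<noteq> 0" "q \<noteq> 0"
    using \<open>w \<noteq> 1\<close> complex_cnj_cancel_iff[of w 1] by (auto simp: p_def q_def)
  have "\<zeta> * cnj \<zeta> = 1" using \<zeta> by (simp add: complex_norm_square[symmetric])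
  then have "\<zeta> * (1 - cnj w) = \<zeta> - z" by (simp add: w_def algebra_simps)
  then have "cmod (\<zeta> - z) = cmod \<zeta> * cmod (1 - cnj w)" by (metis norm_mult)
  then have "cmod (\<zeta> - z) = cmod (1 - w)"
    using \<zeta> complex_mod_cnj[of "1 - w"] by simp
  then have "of_real ((1 - (cmod z)\<^sup>2) / (cmod (\<zeta> - z))\<^sup>2) = (1 - w * cnj w) / ((1 - w) * cnj (1 - w))"
    unfolding cw[symmetric] of_real_divide of_real_diff by (simp only: complex_norm_square of_real_1)
  also have "\<dots> = (p + q - p * q) / (p * q)"
    by (simp add: p_def q_def algebra_simps)
  also have "\<dots> = 1 / q + 1 / p - 1"
    using nz by (simp add: add_divide_distrib diff_divide_distrib)
  finally show ?thesis by (simp add: szego_kernel_def w_def p_def q_def)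
qed

text \<open>The Poisson kernel is the sum of the Szego kernel and its conjugate, minus \<open>1\<close>. So the
  Poisson extension splits into a holomorphic and an antiholomorphic part, both Cauchy
  transforms.\<close>

lemma poisson_eq_cauchy_transforms:
  assumes g: "g \<in> L2_circle" and z: "cmod z < 1"
  shows "poisson g z =
    cauchy_transform g z + cnj (cauchy_transform (\<lambda>\<zeta>. cnj (g \<zeta>)) z) - L2_inner g (\<lambda>_. 1)"
proof -
  let ?s = "\<lambda>\<zeta>. szego_kernel \<zeta> z"
  have s: "?s \<in> L2_circle" by (rule szego_in_L2[OF z])
  have int: "integrable circle_measure (\<lambda>\<zeta>. g \<zeta> * cnj (?s \<zeta>))" "integrable circle_measure (\<lambda>\<zeta>. g \<zeta> * ?s \<zeta>)"
    using L2_product_integrable[OF g s] L2_product_integrable[OF g L2_cnj[OF s]] by simp_all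
  have "poisson g z = (LINT \<zeta>|circle_measure. g \<zeta> * cnj (?s \<zeta>) + g \<zeta> * ?s \<zeta> - g \<zeta>)"
    unfolding poisson_def
  proof (rule Bochner_Integration.integral_cong)
    fix \<zeta> assume "\<zeta> \<in> space circle_measure"
    then have "cmod \<zeta> = 1" by simp
    then show "of_real ((1 - (cmod z)\<^sup>2) / (cmod (\<zeta> - z))\<^sup>2) * g \<zeta> = g \<zeta> * cnj (?s \<zeta>) + g \<zeta> * ?s \<zeta> - g \<zeta>"
      unfolding poisson_kernel_eq[OF \<open>cmod \<zeta> = 1\<close> z] by (simp only: ring_distribs mult_1_left) (simp add: mult.commute)
  qed simp
  also have "\<dots> = (LINT \<zeta>|circle_measure. g \<zeta> * cnj (?s \<zeta>)) + (LINT \<zeta>|circle_measure. g \<zeta> * ?s \<zeta>) -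
      (LINT \<zeta>|circle_measure. g \<zeta>)"
    using int L2_integrable[OF g] by simp
  also have "(LINT \<zeta>|circle_measure. g \<zeta> * ?s \<zeta>) = cnj (cauchy_transform (\<lambda>\<zeta>. cnj (g \<zeta>)) z)"
    unfolding cauchy_transform_def L2_inner_def by (subst Bochner_Integration.integral_cnj[symmetric]) simp
  finally show ?thesis by (simp add: cauchy_transform_def L2_inner_def)
qed

lemma wirtinger_holomorphic_plus_antiholomorphic:
  assumes a: "a holomorphic_on S" and b: "b holomorphic_on S" and S: "open S" "z \<in> S"
    and u: "\<And>w. w \<in> S \<Longrightarrow> u w = a w + cnj (b w) - c"
  shows "wirtinger u z = deriv a z" "wirtinger_bar u z = cnj (deriv b z)"
proof -
  have "(a has_field_derivative deriv a z) (at z)" "(b has_field_derivative deriv b z) (at z)"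
    using a b S holomorphic_derivI by blast+
  then have "(a has_derivative (\<lambda>h. deriv a z * h)) (at z)" "(b has_derivative (\<lambda>h. deriv b z * h)) (at z)"
    by (simp_all add: has_field_derivative_def)
  then have "((\<lambda>w. a w + cnj (b w) - c) has_derivative (\<lambda>h. deriv a z * h + cnj (deriv b z * h) - 0)) (at z)"
    by (intro derivative_intros has_derivative_cnj)
  then have "(u has_derivative (\<lambda>h. deriv a z * h + cnj (deriv b z * h) - 0)) (at z)"
    by (rule has_derivative_transform_within_open[OF _ S]) (simp add: u)
  then have "frechet_derivative u (at z) = (\<lambda>h. deriv a z * h + cnj (deriv b z * h) - 0)"
    by (rule frechet_derivative_at[symmetric])
  then show "wirtinger u z = deriv a z" "wirtinger_bar u z = cnj (deriv b z)"
    by (simp_all add: wirtinger_def wirtinger_bar_def algebra_simps)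
qed

lemma wirtinger_poisson:
  assumes g: "g \<in> L2_circle" and z: "z \<in> ball 0 1"
  shows "wirtinger (poisson g) z = deriv (cauchy_transform g) z"
    and "wirtinger_bar (poisson g) z = cnj (deriv (cauchy_transform (\<lambda>\<zeta>. cnj (g \<zeta>))) z)"
  using wirtinger_holomorphic_plus_antiholomorphic[OF cauchy_transform_holomorphic[OF g]
      cauchy_transform_holomorphic[OF L2_cnj[OF g]] open_ball z, of "poisson g" "L2_inner g (\<lambda>_. 1)"]
    poisson_eq_cauchy_transforms[OF g]
  by simp_all

lemma deriv_eq_on_disc:
  assumes "\<And>w. w \<in> ball 0 1 \<Longrightarrow> f w = g w" and "z \<in> ball 0 1"
  shows "deriv f z = deriv g z"
proof (rule deriv_cong_ev)
  show "\<forall>\<^sub>F w in nhds z. f w = g w"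
    using eventually_nhds_in_open[OF open_ball assms(2)] by eventually_elim (rule assms(1))
qed simp

text \<open>The conjugate of a boundary function of \<open>H\<^sup>2\<close> has constant Cauchy transform, since its
  positive Fourier coefficients vanish. So the Poisson extension of such a boundary function has
  no antiholomorphic part.\<close>

lemma wirtinger_poisson_boundary_function:
  assumes f: "f \<in> hardy2" and z: "z \<in> ball 0 1"
  shows "wirtinger (poisson (boundary_function f)) z = deriv f z"
    and "wirtinger_bar (poisson (boundary_function f)) z = 0"
proof -
  let ?b = "boundary_function f"
  have b: "?b \<in> L2_circle" by (rule boundary_function_L2[OF f])
  show "wirtinger (poisson ?b) z = deriv f z"
    unfolding wirtinger_poisson(1)[OF b z]
    by (rule deriv_eq_on_disc[OF cauchy_transform_boundary_function[OF f] z])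
  have coeff: "L2_inner (\<lambda>\<zeta>. cnj (?b \<zeta>)) (\<lambda>\<zeta>. \<zeta> ^ n) = cnj (L2_inner ?b (\<lambda>\<zeta>. cnj \<zeta> ^ n))" for n
    unfolding L2_inner_def by (subst Bochner_Integration.integral_cnj[symmetric]) simp
  have "cauchy_transform (\<lambda>\<zeta>. cnj (?b \<zeta>)) w = cnj (L2_inner ?b (\<lambda>_. 1))" if w: "w \<in> ball 0 1" for w
  proof -
    have "(\<lambda>n. L2_inner (\<lambda>\<zeta>. cnj (?b \<zeta>)) (\<lambda>\<zeta>. \<zeta> ^ n) * w ^ n) =
        (\<lambda>n. if n = 0 then cnj (L2_inner ?b (\<lambda>_. 1)) else 0)"
      by (auto simp: coeff boundary_function_negative_coefficient[OF f])
    with cauchy_transform_sums[OF _ L2_cnj[OF b], of w] w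
    have "(\<lambda>n. if n = 0 then cnj (L2_inner ?b (\<lambda>_. 1)) else 0) sums cauchy_transform (\<lambda>\<zeta>. cnj (?b \<zeta>)) w"
      by simp
    then show ?thesis
      by (rule sums_unique2) (rule sums_single)
  qed
  then have "deriv (cauchy_transform (\<lambda>\<zeta>. cnj (?b \<zeta>))) z = deriv (\<lambda>_. cnj (L2_inner ?b (\<lambda>_. 1))) z"
    using z by (rule deriv_eq_on_disc)
  then show "wirtinger_bar (poisson ?b) z = 0"
    unfolding wirtinger_poisson(2)[OF b z] by simp
qed

section \<open>The analytic part of a function of finite energy\<close>

lemma space_disc_area [simp]: "space disc_area = ball 0 1"
  by (simp add: disc_area_def)

lemma boundary_function_in_harmonic_dirichlet_space:
  assumes "dirichlet_space \<omega> \<subseteq> hardy2" and f: "f \<in> dirichlet_space \<omega>"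
  shows "boundary_function f \<in> harmonic_dirichlet_space \<omega>"
proof -
  have h: "f \<in> hardy2" using assms by blast
  have "energy_integral \<omega> (boundary_function f) = (\<integral>\<^sup>+z. ennreal ((cmod (deriv f z))\<^sup>2 * \<omega> z) \<partial>disc_area)"
    unfolding energy_integral_def
    by (rule nn_integral_cong) (simp add: wirtinger_poisson_boundary_function[OF h])
  then show ?thesis
    using f boundary_function_L2[OF h] by (simp add: harmonic_dirichlet_space_def dirichlet_space_def)
qed

lemma cauchy_transform_in_dirichlet_space:
  assumes w: "weight \<omega>" and g: "g \<in> harmonic_dirichlet_space \<omega>"
  shows "cauchy_transform g \<in> dirichlet_space \<omega>"
proof -
  have g2: "g \<in> L2_circle" and fin: "energy_integral \<omega> g < \<infinity>"
    using g by (simp_all add: harmonic_dirichlet_space_def)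
  have "(\<integral>\<^sup>+z. ennreal ((cmod (deriv (cauchy_transform g) z))\<^sup>2 * \<omega> z) \<partial>disc_area) \<le> energy_integral \<omega> g"
    unfolding energy_integral_def
  proof (rule nn_integral_mono)
    fix z assume "z \<in> space disc_area"
    then have z: "z \<in> ball 0 1" by simp
    then have "0 \<le> \<omega> z" using w by (simp add: weight_def)
    then show "ennreal ((cmod (deriv (cauchy_transform g) z))\<^sup>2 * \<omega> z) \<le>
        ennreal (((cmod (wirtinger (poisson g) z))\<^sup>2 + (cmod (wirtinger_bar (poisson g) z))\<^sup>2) * \<omega> z)"
      unfolding wirtinger_poisson(1)[OF g2 z] by (intro ennreal_leI mult_right_mono) simp_all
  qed
  then show ?thesis
    using fin cauchy_transform_holomorphic[OF g2] by (auto simp: dirichlet_space_def)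
qed

text \<open>Against an analytic function, both the \<open>L\<^sup>2\<close> product and the energy of \<open>g\<close> see only the
  analytic part of \<open>g\<close>, which is its Cauchy transform.\<close>

lemma dirichlet_inner_cauchy_transform:
  assumes w: "weight \<omega>" and sub: "dirichlet_space \<omega> \<subseteq> hardy2"
    and f: "f \<in> dirichlet_space \<omega>" and g: "g \<in> harmonic_dirichlet_space \<omega>"
  shows "dirichlet_inner \<omega> f (cauchy_transform g) =
    energy \<omega> (boundary_function f) g + L2_inner (boundary_function f) g"
proof -
  have fh: "f \<in> hardy2" using f sub by blast
  have gh: "cauchy_transform g \<in> hardy2"
    using cauchy_transform_in_dirichlet_space[OF w g] sub by blast
  have g2: "g \<in> L2_circle" using g by (simp add: harmonic_dirichlet_space_def)
  have "energy \<omega> (boundary_function f) g =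
      (LINT z|disc_area. deriv f z * cnj (deriv (cauchy_transform g) z) * of_real (\<omega> z))"
    unfolding energy_def
    by (rule Bochner_Integration.integral_cong)
       (simp_all add: wirtinger_poisson_boundary_function[OF fh] wirtinger_poisson(1)[OF g2])
  then show ?thesis
    by (simp add: dirichlet_inner_def L2_inner_boundary_function_cauchy_transform[OF fh g2 gh])
qed

lemma dirichlet_inner_commute:
  assumes "f \<in> hardy2" "g \<in> hardy2"
  shows "dirichlet_inner \<omega> g f = cnj (dirichlet_inner \<omega> f g)"
proof -
  have "(LINT z|disc_area. deriv g z * cnj (deriv f z) * of_real (\<omega> z)) =
      cnj (LINT z|disc_area. deriv f z * cnj (deriv g z) * of_real (\<omega> z))"
    by (subst Bochner_Integration.integral_cnj[symmetric]) (simp add: mult_ac)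
  then show ?thesis
    using L2.sym[OF boundary_function_L2[OF assms(1)] boundary_function_L2[OF assms(2)]]
    by (simp add: dirichlet_inner_def)
qed

theorem theorem3p3:
  fixes \<omega> :: "complex \<Rightarrow> real" and z :: complex
  assumes "douglas_weight \<omega>"
    and "dirichlet_space \<omega> \<subseteq> hardy2"
    and "regular_dirichlet_form (energy \<omega>) (harmonic_dirichlet_space \<omega>)"
    and "z \<in> ball 0 1"
  shows "AE \<zeta> in circle_measure.
    boundary_function (\<lambda>w. dirichlet_kernel \<omega> w z) \<zeta> =
    form_resolvent (energy \<omega>) (harmonic_dirichlet_space \<omega>) (\<lambda>\<xi>. szego_kernel \<xi> z) \<zeta>"
proof -
  let ?F = "harmonic_dirichlet_space \<omega>" and ?s = "\<lambda>\<xi>. szego_kernel \<xi> z"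
  let ?u = "form_resolvent (energy \<omega>) ?F ?s"
  note sub = assms(2)
  have w: "weight \<omega>" using assms(1) by (simp add: douglas_weight_def)
  interpret closed_hermitian_form "energy \<omega>" ?F
    using assms(3) unfolding regular_dirichlet_form_def dirichlet_form_def
    by unfold_locales blast+
  have s: "?s \<in> L2_circle" using assms(4) by (intro szego_in_L2) simp
  have u: "?u \<in> ?F" and u_eq: "\<And>g. g \<in> ?F \<Longrightarrow> energy \<omega> ?u g + L2_inner ?u g = L2_inner ?s g"
    using form_resolvent_solves[OF s] by blast+
  define reproducing where "reproducing k \<longleftrightarrow> k \<in> dirichlet_space \<omega> \<and>
    (\<forall>f\<in>dirichlet_space \<omega>. f z = dirichlet_inner \<omega> f k)" for k
  have "reproducing (cauchy_transform ?u)"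
    unfolding reproducing_def
  proof (intro conjI ballI cauchy_transform_in_dirichlet_space[OF w u])
    fix f assume f: "f \<in> dirichlet_space \<omega>"
    then have fh: "f \<in> hardy2" using sub by blast
    let ?b = "boundary_function f"
    have b: "?b \<in> ?F" by (rule boundary_function_in_harmonic_dirichlet_space[OF sub f])
    have "dirichlet_inner \<omega> f (cauchy_transform ?u) = cnj (energy \<omega> ?u ?b + L2_inner ?u ?b)"
      unfolding dirichlet_inner_cauchy_transform[OF w sub f u]
      using sym[OF u b] L2.sym[OF dom_L2[OF u] dom_L2[OF b]] by simp
    also have "\<dots> = L2_inner ?b ?s"
      unfolding u_eq[OF b] by (rule L2.sym[OF s dom_L2[OF b], symmetric])
    also have "\<dots> = f z"
      using cauchy_transform_boundary_function[OF fh assms(4)] by (simp only: cauchy_transform_def)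
    finally show "f z = dirichlet_inner \<omega> f (cauchy_transform ?u)" ..
  qed
  then have "reproducing (Eps reproducing)" by (rule someI[of reproducing])
  moreover define k where "k = (\<lambda>w. dirichlet_kernel \<omega> w z)"
  moreover have "k = Eps reproducing"
    unfolding k_def dirichlet_kernel_def reproducing_def ..
  ultimately have k: "k \<in> dirichlet_space \<omega>"
    and k_eq: "\<And>f. f \<in> dirichlet_space \<omega> \<Longrightarrow> f z = dirichlet_inner \<omega> f k"
    by (simp_all add: reproducing_def)
  have kh: "k \<in> hardy2" using k sub by blast
  let ?b = "boundary_function k"
  have "AE \<zeta> in circle_measure. ?b \<zeta> = ?u \<zeta>"
  proof (rule variational_solution_unique[OF boundary_function_in_harmonic_dirichlet_space[OF sub k] u])
    fix g assume g: "g \<in> ?F"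
    have C: "cauchy_transform g \<in> dirichlet_space \<omega>"
      by (rule cauchy_transform_in_dirichlet_space[OF w g])
    then have "energy \<omega> ?b g + L2_inner ?b g = cnj (dirichlet_inner \<omega> (cauchy_transform g) k)"
      unfolding dirichlet_inner_cauchy_transform[OF w sub k g, symmetric]
      using sub by (intro dirichlet_inner_commute kh) blast
    also have "\<dots> = cnj (cauchy_transform g z)"
      by (simp only: k_eq[OF C])
    also have "\<dots> = L2_inner ?s g"
      unfolding cauchy_transform_def by (rule L2.sym[OF dom_L2[OF g] s, symmetric])
    finally show "energy \<omega> ?b g + L2_inner ?b g = energy \<omega> ?u g + L2_inner ?u g"
      by (simp only: u_eq[OF g])
  qed
  then show ?thesis by (simp only: k_def)
qed

end
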